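(* Let $n$ and $k$ be positive integers with $k\le n$, let $\delta\in(0,1)$ and $c=10^{-3}\delta$. Suppose $\mathcal{A}\subset\{0,1\}^n$ satisfies $|\mathcal{A}|=m=\binom{n}{\ge k}$ and $|\partial_v(\mathcal{A})|\le (1+\tfrac{c}{n})\binom{n}{k-1}$. Then $|\mathcal{A}\triangle\mathcal{H}|\le \delta\binom{n-1}{k-1}$ for some Hamming ball $\mathcal{H}$. Furthermore, if $|\mathcal{A}\triangle\mathcal{H}|=2D$ then $|\partial_v(\mathcal{A})|\ge|\partial_v(\mathcal{J})|$, where $\mathcal{J}=\mathcal{I}_{m-D}\cup(\mathcal{I}_{m+D}\setminus\mathcal{I}_m)$.
   Context: Subsets of $[n]=\{1,\dots,n\}$ are identified with vectors in $\{0,1\}^n$; $Q_n$ is the graph on $\{0,1\}^n$ in which two vertices are adjacent iff they differ in exactly one coordinate. For $\mathcal{A}\subset\{0,1\}^n$, the vertex boundary is $\partial_v(\mathcal{A})=\{x'\in\{0,1\}^n\setminus\mathcal{A}: xx'\in E(Q_n)\text{ for some }x\in\mathcal{A}\}$. $\binom{n}{\ge k}=\sum_{i=k}^n\binom{n}{i}$. A Hamming ball is a set $\mathcal{B}^n_r(C)=\{A\subset[n]:|A\triangle C|\le r\}$ for some $C\subset[n]$ and $r\ge 0$. The simplicial order on subsets of $[n]$ is: $A<B$ if $|A|>|B|$, or $|A|=|B|$ and $\max(A\triangle B)\in B$; $\mathcal{I}_m$ denotes the initial segment of size $m$ of this order. *)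

theory Defs
  imports Complex_Main
begin

text \<open>
  A 0/1-vector of length \<open>n\<close> is represented by its support, a subset of \<open>{1..n}\<close>.
\<close>

definition cube :: "nat \<Rightarrow> nat set set" where
  "cube n = Pow {1..n}"

text \<open>Two vectors differ exactly in the coordinates lying in the symmetric difference of
  their supports.\<close>

definition cube_adj :: "nat \<Rightarrow> nat set \<Rightarrow> nat set \<Rightarrow> bool" where
  "cube_adj n x y \<longleftrightarrow> x \<in> cube n \<and> y \<in> cube n \<and> card (sym_diff x y) = 1"

definition vertex_boundary :: "nat \<Rightarrow> nat set set \<Rightarrow> nat set set" where
  "vertex_boundary n \<A> = {y \<in> cube n - \<A>. \<exists>x\<in>\<A>. cube_adj n x y}"

definition ball_at :: "nat \<Rightarrow> nat \<Rightarrow> nat set \<Rightarrow> nat set set" where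
  "ball_at n r C = {A \<in> cube n. card (sym_diff A C) \<le> r}"

definition hamming_ball :: "nat \<Rightarrow> nat set set \<Rightarrow> bool" where
  "hamming_ball n \<H> \<longleftrightarrow> (\<exists>C\<in>cube n. \<exists>r. \<H> = ball_at n r C)"

text \<open>The condition \<open>A \<noteq> B\<close> is implicit in the usual formulation, where the maximum of the
  symmetric difference has to exist.\<close>

definition simplicial_less :: "nat set \<Rightarrow> nat set \<Rightarrow> bool" where
  "simplicial_less A B \<longleftrightarrow>
     card A > card B \<or> (card A = card B \<and> A \<noteq> B \<and> Max (sym_diff A B) \<in> B)"

text \<open>The first \<open>m\<close> elements of the cube: those with fewer than \<open>m\<close> predecessors.  The
  lemmas below show that for \<open>m \<le> 2 ^ n\<close> this is the unique down-closed subset of size \<open>m\<close>.\<close>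

definition initial_segment :: "nat \<Rightarrow> nat \<Rightarrow> nat set set" where
  "initial_segment n m =
     {A \<in> cube n. card {B \<in> cube n. simplicial_less B A} < m}"

lemma finite_cube: "finite (cube n)"
  by (simp add: cube_def)

lemma card_cube: "card (cube n) = 2 ^ n"
  by (simp add: cube_def card_Pow)

lemma finite_in_cube: "A \<in> cube n \<Longrightarrow> finite A"
  by (auto simp: cube_def intro: finite_subset)

lemma simplicial_less_irrefl: "\<not> simplicial_less A A"
  by (simp add: simplicial_less_def)

lemma simplicial_less_total:
  assumes "finite A" "finite B" "A \<noteq> B"
  shows "simplicial_less A B \<or> simplicial_less B A"
proof -
  have "Max (sym_diff A B) \<in> sym_diff A B"
    using assms by (intro Max_in) auto
  then show ?thesis
    using assms by (auto simp: simplicial_less_def Un_commute)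
qed

lemma Max_sym_diff_in_iff:
  fixes A B :: "nat set"
  assumes "finite A" "finite B"
  shows "A \<noteq> B \<and> Max (sym_diff A B) \<in> B \<longleftrightarrow>
    (\<exists>x\<in>B - A. \<forall>y>x. y \<in> A \<longleftrightarrow> y \<in> B)" (is "?L \<longleftrightarrow> ?R")
proof
  assume L: ?L
  let ?x = "Max (sym_diff A B)"
  have fin: "finite (sym_diff A B)" using assms by auto
  have "?x \<in> sym_diff A B" using L fin by (intro Max_in) auto
  moreover have "y \<in> A \<longleftrightarrow> y \<in> B" if "y > ?x" for y
    using Max_ge[OF fin, of y] that by fastforce
  ultimately show ?R using L by blast
next
  assume ?R
  then obtain x where x: "x \<in> B" "x \<notin> A" "\<forall>y>x. y \<in> A \<longleftrightarrow> y \<in> B" by blast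
  have "Max (sym_diff A B) = x"
  proof (rule Max_eqI)
    show "y \<le> x" if "y \<in> sym_diff A B" for y
      using x(3) that by (meson DiffE UnE not_le)
  qed (use x assms in auto)
  then show ?L using x by auto
qed

lemma simplicial_less_trans:
  assumes fin: "finite A" "finite B" "finite C"
    and AB: "simplicial_less A B" and BC: "simplicial_less B C"
  shows "simplicial_less A C"
proof (cases "card A = card B \<and> card B = card C")
  case True
  obtain x where x: "x \<in> B - A" "\<forall>y>x. y \<in> A \<longleftrightarrow> y \<in> B"
    using AB True Max_sym_diff_in_iff[OF fin(1,2)] by (auto simp: simplicial_less_def)
  obtain z where z: "z \<in> C - B" "\<forall>y>z. y \<in> B \<longleftrightarrow> y \<in> C"
    using BC True Max_sym_diff_in_iff[OF fin(2,3)] by (auto simp: simplicial_less_def)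
  have "max x z \<in> C - A" "\<forall>y>max x z. y \<in> A \<longleftrightarrow> y \<in> C"
    using x z by (cases x z rule: linorder_cases; auto)+
  then have "A \<noteq> C \<and> Max (sym_diff A C) \<in> C"
    by (subst Max_sym_diff_in_iff[OF fin(1,3)]) (rule bexI)
  then show ?thesis using True by (simp add: simplicial_less_def)
next
  case False
  then show ?thesis using AB BC by (auto simp: simplicial_less_def)
qed

lemma initial_segment_down_closed:
  assumes "A \<in> initial_segment n m" "B \<in> cube n" "simplicial_less B A"
  shows "B \<in> initial_segment n m"
proof -
  have "{X \<in> cube n. simplicial_less X B} \<subseteq> {X \<in> cube n. simplicial_less X A}"
  proof
    fix X assume "X \<in> {X \<in> cube n. simplicial_less X B}"
    then have "X \<in> cube n" "simplicial_less X A"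
      using assms simplicial_less_trans[of X B A] finite_in_cube[of _ n]
      by (simp_all add: initial_segment_def)
    then show "X \<in> {X \<in> cube n. simplicial_less X A}" by simp
  qed
  then have "card {X \<in> cube n. simplicial_less X B} \<le> card {X \<in> cube n. simplicial_less X A}"
    by (intro card_mono) (auto simp: finite_cube)
  then show ?thesis using assms by (auto simp: initial_segment_def)
qed

lemma card_initial_segment:
  assumes "m \<le> 2 ^ n"
  shows "card (initial_segment n m) = m"
proof -
  define rk where "rk A = card {B \<in> cube n. simplicial_less B A}" for A
  have less: "rk A < rk B"
    if "A \<in> cube n" "B \<in> cube n" "simplicial_less A B" for A B
    unfolding rk_def
  proof (rule psubset_card_mono)
    show "{X \<in> cube n. simplicial_less X A} \<subset> {X \<in> cube n. simplicial_less X B}"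
    proof (rule psubsetI)
      show "{X \<in> cube n. simplicial_less X A} \<subseteq> {X \<in> cube n. simplicial_less X B}"
      proof
        fix X assume "X \<in> {X \<in> cube n. simplicial_less X A}"
        then have "X \<in> cube n" "simplicial_less X B"
          using that simplicial_less_trans[of X A B] finite_in_cube[of _ n] by simp_all
        then show "X \<in> {X \<in> cube n. simplicial_less X B}" by simp
      qed
      have "A \<in> {X \<in> cube n. simplicial_less X B}" "A \<notin> {X \<in> cube n. simplicial_less X A}"
        using that simplicial_less_irrefl by simp_all
      then show "{X \<in> cube n. simplicial_less X A} \<noteq> {X \<in> cube n. simplicial_less X B}"
        by metis
    qed
  qed (simp add: finite_cube)
  have inj: "inj_on rk (cube n)"
    by (rule inj_onI) (metis less simplicial_less_total finite_in_cube less_irrefl)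
  have "rk A < card (cube n)" if "A \<in> cube n" for A
    unfolding rk_def
    using that by (intro psubset_card_mono finite_cube) (use simplicial_less_irrefl in blast)
  then have sub: "rk ` cube n \<subseteq> {..<card (cube n)}" by blast
  have img: "rk ` cube n = {..<card (cube n)}"
    by (rule card_subset_eq) (use sub inj card_image in auto)
  have "rk ` initial_segment n m = {..<m}"
  proof
    show "rk ` initial_segment n m \<subseteq> {..<m}"
      by (auto simp: initial_segment_def rk_def)
    show "{..<m} \<subseteq> rk ` initial_segment n m"
    proof
      fix i assume i: "i \<in> {..<m}"
      then have "i \<in> rk ` cube n" using assms img by (simp add: card_cube)
      then show "i \<in> rk ` initial_segment n m"
        using i by (auto simp: initial_segment_def rk_def)
    qed
  qed
  moreover have "inj_on rk (initial_segment n m)"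
    by (rule inj_on_subset[OF inj]) (auto simp: initial_segment_def)
  ultimately show ?thesis by (metis card_image card_lessThan)
qed

lemma initial_segment_unique:
  assumes sub: "\<I> \<subseteq> cube n" and card: "card \<I> = m"
    and down: "\<And>A B. A \<in> \<I> \<Longrightarrow> B \<in> cube n \<Longrightarrow> simplicial_less B A \<Longrightarrow> B \<in> \<I>"
  shows "\<I> = initial_segment n m"
proof -
  have m: "m \<le> 2 ^ n"
    using card_mono[OF finite_cube sub] card by (simp add: card_cube)
  have "\<I> \<subseteq> initial_segment n m"
  proof
    fix A assume A: "A \<in> \<I>"
    have "{B \<in> cube n. simplicial_less B A} \<subset> \<I>"
      using A down simplicial_less_irrefl by blast
    then have "card {B \<in> cube n. simplicial_less B A} < m"
      using card finite_subset[OF sub finite_cube] psubset_card_mono by blast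
    then show "A \<in> initial_segment n m" using A sub by (auto simp: initial_segment_def)
  qed
  moreover have "finite (initial_segment n m)"
    by (auto simp: initial_segment_def finite_cube)
  ultimately show ?thesis
    using card_initial_segment[OF m] card by (metis card_subset_eq)
qed

end

theory Submission
  imports Defs
begin

text \<open>
  Replace a set \<open>V\<close> of coordinates by a disjoint set \<open>U\<close> with \<open>|U| = |V| + 1\<close>, wherever possible.
  Performed in order of increasing \<open>|V|\<close>, these compressions do not enlarge closed
  neighbourhoods, and a family stable under all of them is a union of top layers plus part of the
  next layer; at size \<open>\<Sum>i\<ge>k. n choose i\<close> it is exactly the ball \<open>H\<close> of sets of size at least \<open>k\<close>.

  Put \<open>M = (n - 1) choose (k - 1)\<close>. If \<open>A\<close> has \<open>D \<le> M\<close> elements outside a ball of its own size,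
  Harper's theorem applied to \<open>A \<inter> H\<close> and to \<open>A \<union> H\<close> gives the sharp bound of the second claim.
  Its excess over the boundary of the ball is
  \<open>\<partial>(D) + \<partial>(M - D) - \<partial>(M)\<close>, where \<open>\<partial>(j)\<close> is the minimal shadow of \<open>j\<close> sets of size \<open>k - 1\<close>. By
  Lovasz's form of the Kruskal--Katona theorem this is at least \<open>min D (M - D) / (2 (n - k + 1))\<close>, so
  a small boundary forces \<open>D\<close> to be very close to \<open>0\<close> or to \<open>M\<close>.

  Now undo the compressions one at a time, starting from the ball. An up-set stays an up-set for
  \<open>|V| \<ge> 1\<close>, and one step increases \<open>D\<close> by at most \<open>M / 2\<close>, which cannot cross the gap. Undoing a
  compression with \<open>V = {}\<close> and \<open>U = {i}\<close> swaps \<open>s \<le> M\<close> of the \<open>M\<close> pairs separated by the ball: if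
  \<open>s \<le> M / 2\<close> the old centre still works, otherwise the centre with coordinate \<open>i\<close> flipped does.
\<close>

section \<open>Compressions and neighbourhoods\<close>

definition swap :: "'a set \<Rightarrow> 'a set \<Rightarrow> 'a set \<Rightarrow> 'a set" where
  "swap U V x = (x - V) \<union> U"

text \<open>Sets containing \<open>V\<close> and missing \<open>U\<close> are paired with their
  images under \<open>swap U V\<close>; in each pair the partner containing \<open>U\<close> is
  filled first. Stating this as a membership test makes monotonicity in \<open>F\<close>
  immediate.\<close>

definition compr :: "'a set \<Rightarrow> 'a set \<Rightarrow> 'a set set \<Rightarrow> 'a set set" where
  "compr U V F = {x. if V \<subseteq> x \<and> U \<inter> x = {} then x \<in> F \<and> swap U V x \<in> F
     else if U \<subseteq> x \<and> V \<inter> x = {} then x \<in> F \<or> swap V U x \<in> F else x \<in> F}"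

text \<open>The image of a single member \<open>x\<close> of \<open>F\<close> under the compression of \<open>F\<close>; this makes
  \<open>compr U V F\<close> a bijective image of \<open>F\<close>.\<close>

definition push :: "'a set \<Rightarrow> 'a set \<Rightarrow> 'a set set \<Rightarrow> 'a set \<Rightarrow> 'a set" where
  "push U V F x = (if V \<subseteq> x \<and> U \<inter> x = {} \<and> swap U V x \<notin> F then swap U V x else x)"

definition compr_stable :: "'a set \<Rightarrow> 'a set \<Rightarrow> 'a set set \<Rightarrow> bool" where
  "compr_stable U V F \<longleftrightarrow> (\<forall>x\<in>F. V \<subseteq> x \<longrightarrow> U \<inter> x = {} \<longrightarrow> swap U V x \<in> F)"

lemma compr_stableD: "compr_stable U V F \<Longrightarrow> x \<in> F \<Longrightarrow> V \<subseteq> x \<Longrightarrow> U \<inter> x = {} \<Longrightarrow> (x - V) \<union> U \<in> F"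
  by (auto simp: compr_stable_def swap_def)

lemma swap_swap: "U \<inter> V = {} \<Longrightarrow> V \<subseteq> x \<Longrightarrow> U \<inter> x = {} \<Longrightarrow> swap V U (swap U V x) = x"
  by (auto simp: swap_def)

lemma swap_image: "U \<inter> V = {} \<Longrightarrow> V \<subseteq> x \<Longrightarrow> U \<inter> x = {} \<Longrightarrow>
    U \<subseteq> swap U V x \<and> V \<inter> swap U V x = {}"
  by (auto simp: swap_def)

lemma compr_mono: "F \<subseteq> G \<Longrightarrow> compr U V F \<subseteq> compr U V G"
  by (auto simp: compr_def split: if_splits)

lemma comprI: "x \<in> F \<Longrightarrow> (V \<subseteq> x \<Longrightarrow> U \<inter> x = {} \<Longrightarrow> swap U V x \<in> F) \<Longrightarrow> x \<in> compr U V F"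
  by (simp add: compr_def)

text \<open>A moved set lands outside \<open>F\<close> and an unmoved one stays in \<open>F\<close>,
  so the two kinds of image never collide; a moved set is recovered by swapping back.\<close>

lemma push_bij:
  assumes "U \<inter> V = {}"
  shows "bij_betw (push U V F) F (compr U V F)"
proof (rule bij_betwI')
  fix x y assume xy: "x \<in> F" "y \<in> F"
  let ?moved = "\<lambda>x. V \<subseteq> x \<and> U \<inter> x = {} \<and> swap U V x \<notin> F"
  show "push U V F x = push U V F y \<longleftrightarrow> x = y"
  proof
    assume eq: "push U V F x = push U V F y"
    have *: "(?moved z \<and> push U V F z \<notin> F \<and> swap V U (push U V F z) = z) \<or> (push U V F z \<in> F \<and> push U V F z = z)"
      if "z \<in> F" for z
    proof (cases "?moved z")
      case True
      then have "push U V F z = swap U V z" by (simp only: push_def if_True simp_thms)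
      then show ?thesis using True swap_swap[OF assms, of z] by metis
    next
      case False
      then have "push U V F z = z" by (simp only: push_def if_False)
      then show ?thesis using that by metis
    qed
    show "x = y" using *[OF xy(1)] *[OF xy(2)] eq by metis
  qed simp
next
  fix x assume x: "x \<in> F"
  show "push U V F x \<in> compr U V F"
  proof (cases "V \<subseteq> x \<and> U \<inter> x = {}")
    case True
    then show ?thesis
    proof (cases "swap U V x \<in> F")
      case False
      \<comment> \<open>Only \<open>U = V = {}\<close> could leave the swapped set in source
        position, and then the swap moves nothing.\<close>
      have "\<not> (V \<subseteq> swap U V x \<and> U \<inter> swap U V x = {})"
      proof
        assume a: "V \<subseteq> swap U V x \<and> U \<inter> swap U V x = {}"
        then have "U = {}" "V = {}" using swap_image[OF assms, of x] True by (metis inf.absorb_iff1)+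
        then show False using False x by (simp add: swap_def)
      qed
      then show ?thesis using False True x swap_image[OF assms, of x] swap_swap[OF assms, of x]
        by (auto simp: push_def compr_def)
    qed (use x in \<open>auto simp: push_def compr_def\<close>)
  qed (use x in \<open>auto simp: push_def compr_def\<close>)
next
  fix y assume y: "y \<in> compr U V F"
  show "\<exists>x\<in>F. y = push U V F x"
  proof (cases "y \<in> F")
    case True
    then have "push U V F y = y" using y by (auto simp: push_def compr_def)
    then show ?thesis using True by metis
  next
    case False
    then have a: "U \<subseteq> y" "V \<inter> y = {}" "swap V U y \<in> F"
      using y by (auto simp: compr_def split: if_splits)
    have "V \<inter> U = {}" using assms by blast
    then have "push U V F (swap V U y) = y"
      using a False swap_image[of V U y] swap_swap[of V U y] by (simp add: push_def)
    then show ?thesis using a by metis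
  qed
qed

lemma card_compr: "U \<inter> V = {} \<Longrightarrow> card (compr U V F) = card F"
  using push_bij bij_betw_same_card by metis

lemma finite_compr: "U \<inter> V = {} \<Longrightarrow> finite F \<Longrightarrow> finite (compr U V F)"
  using push_bij bij_betw_finite by metis

lemma compr_sub:
  assumes "U \<inter> V = {}" "x \<in> compr U V F"
  shows "x \<in> F \<or> (\<exists>y\<in>F. x = swap U V y \<and> V \<subseteq> y \<and> U \<inter> y = {})"
proof -
  obtain y where "y \<in> F" "x = push U V F y"
    using push_bij[OF assms(1), of F] assms(2) unfolding bij_betw_def by blast
  then show ?thesis by (auto simp: push_def split: if_splits)
qed

text \<open>The descent principle behind every extremal choice and induction on families below.
  Reindexing by \<open>push\<close> compares the sums term by term, and instability provides a set
  that really moves.\<close>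

lemma sum_compr_less:
  fixes w :: "'a set \<Rightarrow> nat"
  assumes UV: "U \<inter> V = {}" and fin: "finite F" and ns: "\<not> compr_stable U V F"
    and w: "\<And>x. x \<in> F \<Longrightarrow> V \<subseteq> x \<Longrightarrow> U \<inter> x = {} \<Longrightarrow> w (swap U V x) < w x"
  shows "sum w (compr U V F) < sum w F"
proof -
  have "sum w (compr U V F) = (\<Sum>x\<in>F. w (push U V F x))"
    using sum.reindex_bij_betw[OF push_bij[OF UV], of w F] by simp
  also have "\<dots> < sum w F"
  proof (rule sum_strict_mono_ex1[OF fin])
    show "\<forall>x\<in>F. w (push U V F x) \<le> w x" using w by (auto simp: push_def intro: less_imp_le)
    show "\<exists>x\<in>F. w (push U V F x) < w x" using ns w by (auto simp: push_def compr_stable_def)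
  qed
  finally show ?thesis .
qed

text \<open>Closed neighbourhoods are easier to compare than boundaries: they are monotone and additive.\<close>

definition nbr :: "nat \<Rightarrow> nat set set \<Rightarrow> nat set set" where
  "nbr n A = {y \<in> cube n. y \<in> A \<or> (\<exists>i\<in>{1..n}. sym_diff y {i} \<in> A)}"

lemma nbr_eq: "A \<subseteq> cube n \<Longrightarrow> nbr n A = A \<union> vertex_boundary n A"
proof -
  assume A: "A \<subseteq> cube n"
  have "sym_diff (sym_diff y x) y = x" for x y :: "nat set" by auto
  have *: "(\<exists>x\<in>A. cube_adj n x y) \<longleftrightarrow> (\<exists>i\<in>{1..n}. sym_diff y {i} \<in> A)" if "y \<in> cube n" for y
  proof
    assume "\<exists>x\<in>A. cube_adj n x y"
    then obtain x i where x: "x \<in> A" "x \<in> cube n" "sym_diff x y = {i}"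
      by (auto simp: cube_adj_def card_1_singleton_iff)
    have "sym_diff y {i} = x" unfolding x(3)[symmetric] by auto
    moreover have "i \<in> {1..n}" using x that unfolding cube_def by blast
    ultimately show "\<exists>i\<in>{1..n}. sym_diff y {i} \<in> A" using x by blast
  next
    assume "\<exists>i\<in>{1..n}. sym_diff y {i} \<in> A"
    then obtain i where i: "i \<in> {1..n}" "sym_diff y {i} \<in> A" by blast
    have "sym_diff (sym_diff y {i}) y = {i}" by auto
    then have "card (sym_diff (sym_diff y {i}) y) = 1" by simp
    then show "\<exists>x\<in>A. cube_adj n x y" using i A that unfolding cube_adj_def by blast
  qed
  show ?thesis
  proof (rule set_eqI)
    fix y show "y \<in> nbr n A \<longleftrightarrow> y \<in> A \<union> vertex_boundary n A"
      using *[of y] A unfolding nbr_def vertex_boundary_def by blast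
  qed
qed

lemma card_nbr: "A \<subseteq> cube n \<Longrightarrow> card (nbr n A) = card A + card (vertex_boundary n A)"
  unfolding nbr_eq using finite_cube[of n]
  by (subst card_Un_disjoint) (auto simp: vertex_boundary_def intro: finite_subset)

lemma nbr_cube: "nbr n A \<subseteq> cube n" by (auto simp: nbr_def)

lemma finite_nbr [simp]: "finite (nbr n A)"
  using nbr_cube finite_cube finite_subset by metis

lemma nbr_mono: "A \<subseteq> B \<Longrightarrow> nbr n A \<subseteq> nbr n B" by (auto simp: nbr_def)

lemma nbr_Un: "nbr n (A \<union> B) = nbr n A \<union> nbr n B" by (auto simp: nbr_def)

lemma nbr_self: "A \<subseteq> cube n \<Longrightarrow> A \<subseteq> nbr n A" by (auto simp: nbr_def)

lemma nbr_toggle: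
  assumes "x \<in> A" "A \<subseteq> cube n" "i \<in> {1..n}"
  shows "sym_diff x {i} \<in> nbr n A"
proof -
  have "sym_diff (sym_diff x {i}) {i} = x" by auto
  then have "\<exists>j\<in>{1..n}. sym_diff (sym_diff x {i}) {j} \<in> A"
    using assms by (intro bexI[of _ i]) simp_all
  moreover have "sym_diff x {i} \<in> cube n" using assms by (auto simp: cube_def)
  ultimately show ?thesis by (simp add: nbr_def)
qed

lemma nbr_insertI:
  assumes "x \<in> A" "A \<subseteq> cube n" "i \<in> {1..n}"
  shows "insert i x \<in> nbr n A"
proof (cases "i \<in> x")
  case False
  then have "insert i x = sym_diff x {i}" by auto
  then show ?thesis using nbr_toggle[OF assms] by simp
next
  case True
  then show ?thesis using nbr_self[OF assms(2)] assms(1) by (simp add: insert_absorb subsetD)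
qed

lemma nbr_removeI:
  assumes "x \<in> A" "A \<subseteq> cube n"
  shows "x - {i} \<in> nbr n A"
proof (cases "i \<in> x")
  case True
  then have "x - {i} = sym_diff x {i}" by auto
  moreover have "i \<in> {1..n}" using True assms unfolding cube_def by blast
  ultimately show ?thesis using nbr_toggle[OF assms] by metis
next
  case False
  then show ?thesis using nbr_self[OF assms(2)] assms(1) by (simp add: subsetD)
qed

lemma nbrE:
  assumes "y \<in> nbr n A"
  obtains (self) "y \<in> A" | (remove) i where "i \<in> {1..n}" "i \<in> y" "y - {i} \<in> A"
    | (insert) i where "i \<in> {1..n}" "i \<notin> y" "insert i y \<in> A"
proof -
  have *: "sym_diff y {i} = (if i \<in> y then y - {i} else insert i y)" for i by auto
  show ?thesis using assms that unfolding nbr_def mem_Collect_eq * by (metis (full_types))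
qed

section \<open>Compressions do not enlarge closed neighbourhoods\<close>

lemma compr_cube:
  assumes "U \<inter> V = {}" "U \<subseteq> {1..n}" "F \<subseteq> cube n"
  shows "compr U V F \<subseteq> cube n"
proof
  fix x assume "x \<in> compr U V F"
  then show "x \<in> cube n" using compr_sub[OF assms(1)] assms by (fastforce simp: cube_def swap_def)
qed

text \<open>Toggling a coordinate outside \<open>U \<union> V\<close> commutes with the swap, so
  only toggles inside \<open>U\<close> or \<open>V\<close> need an argument. \<open>Q1\<close> and
  \<open>Q2\<close> isolate these: they concern swaps that put in one element of \<open>U\<close>
  fewer or take out one element of \<open>V\<close> fewer.\<close>

lemma nbr_compr:
  assumes UV: "U \<inter> V = {}" "U \<noteq> {}" "U \<subseteq> {1..n}" "V \<subseteq> {1..n}" and F: "F \<subseteq> cube n"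
    and Q1: "\<And>u x. u \<in> U \<Longrightarrow> x \<in> F \<Longrightarrow> V \<subseteq> x \<Longrightarrow> (U - {u}) \<inter> x = {} \<Longrightarrow> (x - V) \<union> (U - {u}) \<in> nbr n F"
    and Q2: "\<And>v x. v \<in> V \<Longrightarrow> x \<in> F \<Longrightarrow> V - {v} \<subseteq> x \<Longrightarrow> U \<inter> x = {} \<Longrightarrow> (x - (V - {v})) \<union> U \<in> nbr n F"
  shows "nbr n (compr U V F) \<subseteq> compr U V (nbr n F)"
proof
  fix y assume "y \<in> nbr n (compr U V F)"
  then have yc: "y \<in> cube n" and y: "y \<in> compr U V F \<or> (\<exists>i\<in>{1..n}. sym_diff y {i} \<in> compr U V F)"
    by (auto simp: nbr_def)
  show "y \<in> compr U V (nbr n F)"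
  proof (cases "y \<in> compr U V F")
    case True
    then show ?thesis using compr_mono[OF nbr_self[OF F]] by blast
  next
    case False
    then obtain i where i: "i \<in> {1..n}" "sym_diff y {i} \<in> compr U V F" using y by blast
    define z where "z = sym_diff y {i}"
    have yz: "y = sym_diff z {i}" by (auto simp: z_def)
    have z: "z \<in> compr U V F" using i by (simp add: z_def)
    have toggle: "sym_diff x {i} \<in> nbr n F" if "x \<in> F" for x
      using nbr_toggle[OF that F i(1)] .
    show ?thesis
    proof (cases "i \<in> U \<union> V")
      case False
      then have 1: "V \<subseteq> y \<longleftrightarrow> V \<subseteq> z" "U \<inter> y = {} \<longleftrightarrow> U \<inter> z = {}" "U \<subseteq> y \<longleftrightarrow> U \<subseteq> z"
         "V \<inter> y = {} \<longleftrightarrow> V \<inter> z = {}" by (auto simp: yz)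
      have 2: "swap U V y = sym_diff (swap U V z) {i}" "swap V U y = sym_diff (swap V U z) {i}"
        using False by (auto simp: swap_def yz)
      show ?thesis using z toggle[of z] toggle[of "swap U V z"] toggle[of "swap V U z"]
        unfolding compr_def mem_Collect_eq 1 2 yz[symmetric] by (auto split: if_splits)
    next
      case iUV: True
      show ?thesis
      proof (cases "z \<in> F")
        case True
        then have ynF: "y \<in> nbr n F" using toggle yz by metis
        have "swap U V y \<in> nbr n F" if a: "V \<subseteq> y" "U \<inter> y = {}"
        proof (cases "i \<in> U")
          case iU: True
          have "(z - V) \<union> (U - {i}) \<in> nbr n F"
            using iU a True UV(1) by (intro Q1) (auto simp: z_def)
          also have "(z - V) \<union> (U - {i}) = swap U V y" using iU a UV(1) by (auto simp: z_def swap_def)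
          finally show ?thesis .
        next
          case iU: False
          then have iV: "i \<in> V" using iUV by auto
          have "(z - (V - {i})) \<union> U \<in> nbr n F"
            using iV a True UV(1) by (intro Q2) (auto simp: z_def)
          also have "(z - (V - {i})) \<union> U = swap U V y" using iV a UV(1) by (auto simp: z_def swap_def)
          finally show ?thesis .
        qed
        then show ?thesis using ynF by (auto simp: compr_def)
      next
        case False
        then obtain x where x: "x \<in> F" "z = swap U V x" "V \<subseteq> x" "U \<inter> x = {}"
          using compr_sub[OF UV(1) z] by (elim disjE bexE conjE) blast+
        show ?thesis
        proof (cases "i \<in> U")
          case iU: True
          have y': "y = (x - V) \<union> (U - {i})" using iU x by (auto simp: yz swap_def)
          have 1: "y \<in> nbr n F" unfolding y' using x iU by (intro Q1) auto
          \<comment> \<open>Since \<open>y\<close> contains \<open>U - {i}\<close> and meets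
            \<open>V\<close> in nothing, it can be in source position only for the one-coordinate
            compression, whose swap restores \<open>insert i x\<close>.\<close>
          have "swap U V y \<in> nbr n F" if "V \<subseteq> y" "U \<inter> y = {}"
          proof -
            have "V = {}" "U = {i}" using that UV x iU unfolding y' by auto
            then have "swap U V y = insert i x" using y' by (auto simp: swap_def)
            then show ?thesis using nbr_insertI[OF x(1) F i(1)] by simp
          qed
          then show ?thesis using 1 by (auto simp: compr_def)
        next
          case iU: False
          then have iV: "i \<in> V" using iUV by auto
          have y': "y = (x - (V - {i})) \<union> U" using iV UV(1) x by (auto simp: yz swap_def)
          have 1: "y \<in> nbr n F" unfolding y' using x iV by (intro Q2) auto
          have "\<not> (U \<inter> y = {})" using y' UV(2) by auto
          then show ?thesis using 1 by (auto simp: compr_def)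
        qed
      qed
    qed
  qed
qed

lemma card_nbr_compr_le:
  assumes "U \<inter> V = {}" "nbr n (compr U V F) \<subseteq> compr U V (nbr n F)"
  shows "card (nbr n (compr U V F)) \<le> card (nbr n F)"
  using card_mono[OF finite_compr[OF assms(1) finite_nbr] assms(2)] card_compr[OF assms(1)] by metis

text \<open>The swap for \<open>U - {u}\<close>, \<open>V - {v}\<close> stays in \<open>F\<close> by
  stability. Removing \<open>v\<close> from the result gives the set wanted in \<open>Q1\<close>,
  and inserting \<open>u\<close> gives the set wanted in \<open>Q2\<close>.\<close>

lemma card_nbr_compr_up:
  assumes UV: "U \<inter> V = {}" "card U = Suc (card V)" "U \<subseteq> {1..n}" "V \<subseteq> {1..n}" and F: "F \<subseteq> cube n"
    and st: "\<And>u v. u \<in> U \<Longrightarrow> v \<in> V \<Longrightarrow> compr_stable (U - {u}) (V - {v}) F"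
  shows "card (nbr n (compr U V F)) \<le> card (nbr n F)"
proof (rule card_nbr_compr_le[OF UV(1)], rule nbr_compr[OF UV(1) _ UV(3,4) F])
  have finV: "finite V" "finite U" using UV(3,4) finite_subset by blast+
  show U0: "U \<noteq> {}" using UV(2) by auto
  show "(x - V) \<union> (U - {u}) \<in> nbr n F"
    if "u \<in> U" "x \<in> F" "V \<subseteq> x" "(U - {u}) \<inter> x = {}" for u x
  proof (cases "V = {}")
    case True
    then have "U - {u} = {}" using that(1) UV(2) by (auto simp: card_1_singleton_iff)
    then show ?thesis using True that nbr_self[OF F] by (simp only: Diff_empty Un_empty_right subsetD)
  next
    case False
    then obtain v where v: "v \<in> V" by auto
    have "(x - (V - {v})) \<union> (U - {u}) \<in> F"
      using that by (intro compr_stableD[OF st[OF that(1) v]]) auto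
    moreover have "((x - (V - {v})) \<union> (U - {u})) - {v} = (x - V) \<union> (U - {u})"
      using v UV(1) by blast
    ultimately show ?thesis using nbr_removeI[OF _ F] by metis
  qed
  show "(x - (V - {v})) \<union> U \<in> nbr n F"
    if "v \<in> V" "x \<in> F" "V - {v} \<subseteq> x" "U \<inter> x = {}" for v x
  proof -
    obtain u where u: "u \<in> U" using U0 by auto
    have "(x - (V - {v})) \<union> (U - {u}) \<in> F"
      using that by (intro compr_stableD[OF st[OF u that(1)]]) auto
    moreover have "insert u ((x - (V - {v})) \<union> (U - {u})) = (x - (V - {v})) \<union> U"
      using u by blast
    ultimately show ?thesis using nbr_insertI[OF _ F] u UV(3) by (metis subsetD)
  qed
qed

section \<open>Harper's theorem\<close>

definition up_pair :: "nat \<Rightarrow> nat set \<Rightarrow> nat set \<Rightarrow> bool" where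
  "up_pair n U V \<longleftrightarrow> U \<subseteq> {1..n} \<and> V \<subseteq> {1..n} \<and> U \<inter> V = {} \<and> card U = Suc (card V)"

text \<open>The largest element of \<open>U \<union> V\<close> lies in \<open>V\<close>, so swapping
  keeps the size and moves a set to an earlier place in the simplicial order. The witness also makes
  \<open>V\<close> nonempty.\<close>

definition level_pair :: "nat \<Rightarrow> nat set \<Rightarrow> nat set \<Rightarrow> bool" where
  "level_pair n U V \<longleftrightarrow> U \<subseteq> {1..n} \<and> V \<subseteq> {1..n} \<and> U \<inter> V = {} \<and> card U = card V \<and>
     (\<exists>m\<in>V. \<forall>z\<in>U \<union> V. z \<le> m)"

lemma up_pair_remove:
  assumes "up_pair n U V" "u \<in> U" "v \<in> V"
  shows "up_pair n (U - {u}) (V - {v})" "card (V - {v}) < card V"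
proof -
  have fin: "finite V" using assms(1) finite_subset[of V "{1..n}"] by (simp add: up_pair_def)
  then show less: "card (V - {v}) < card V" using assms(3) by (intro card_Diff1_less)
  have "card (U - {u}) = Suc (card (V - {v}))"
    using assms less fin by (simp add: up_pair_def)
  then show "up_pair n (U - {u}) (V - {v})" using assms(1) unfolding up_pair_def by blast
qed

text \<open>Taking \<open>V\<close> as small as possible provides the stability hypotheses under
  which a compression cannot enlarge the neighbourhood.\<close>

lemma minimal_unstable_up_pair:
  assumes "up_pair n U V" "\<not> compr_stable U V F"
  obtains U V where "up_pair n U V" "\<not> compr_stable U V F"
    "\<And>u v. u \<in> U \<Longrightarrow> v \<in> V \<Longrightarrow> compr_stable (U - {u}) (V - {v}) F"
proof -
  have "\<exists>p. (up_pair n (fst p) (snd p) \<and> \<not> compr_stable (fst p) (snd p) F) \<and>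
    (\<forall>q. up_pair n (fst q) (snd q) \<and> \<not> compr_stable (fst q) (snd q) F \<longrightarrow> card (snd p) \<le> card (snd q))"
    by (rule ex_has_least_nat[of _ "(U, V)"]) (use assms in simp)
  then obtain U V where UV: "up_pair n U V" "\<not> compr_stable U V F"
    "\<And>U' V'. up_pair n U' V' \<Longrightarrow> \<not> compr_stable U' V' F \<Longrightarrow> card V \<le> card V'" by auto
  show ?thesis
  proof (rule that[OF UV(1,2)])
    fix u v assume "u \<in> U" "v \<in> V"
    then show "compr_stable (U - {u}) (V - {v}) F"
      using up_pair_remove[OF UV(1)] UV(3)[of "U - {u}" "V - {v}"] by (metis not_le)
  qed
qed

lemma card_nbr_compr_up_pair:
  assumes "up_pair n U V" "F \<subseteq> cube n"
    and "\<And>u v. u \<in> U \<Longrightarrow> v \<in> V \<Longrightarrow> compr_stable (U - {u}) (V - {v}) F"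
  shows "card (nbr n (compr U V F)) \<le> card (nbr n F)"
  using assms card_nbr_compr_up[of U V n F] by (simp add: up_pair_def)

lemma card_swap_up_pair:
  assumes "up_pair n U V" "V \<subseteq> x" "U \<inter> x = {}" "x \<in> cube n"
  shows "card (swap U V x) = Suc (card x)" "swap U V x \<in> cube n"
proof -
  have fin: "finite x" "finite U" "finite V"
    using assms finite_subset[of _ "{1..n}"] by (auto simp: up_pair_def cube_def)
  have "card (swap U V x) = card (x - V) + card U"
    unfolding swap_def using fin assms by (intro card_Un_disjoint) auto
  also have "card (x - V) = card x - card V" using assms fin by (simp add: card_Diff_subset)
  also have "card x - card V + card U = Suc (card x)"
    using card_mono[OF fin(1) assms(2)] assms(1) by (simp add: up_pair_def)
  finally show "card (swap U V x) = Suc (card x)" .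
  show "swap U V x \<in> cube n" using assms by (auto simp: swap_def up_pair_def cube_def)
qed

section \<open>Up-sets and families stable under all upward compressions\<close>

definition upset :: "nat \<Rightarrow> nat set set \<Rightarrow> bool" where
  "upset n F \<longleftrightarrow> (\<forall>x\<in>F. \<forall>i\<in>{1..n}. insert i x \<in> F)"

lemma upsetD:
  assumes "upset n F" "x \<in> F" "x \<subseteq> y" "y \<subseteq> {1..n}"
  shows "y \<in> F"
proof -
  have "x \<union> z \<in> F" if "finite z" "z \<subseteq> {1..n}" for z
    using that
  proof (induction z)
    case (insert i z)
    then have "insert i (x \<union> z) \<in> F" using assms(1) unfolding upset_def by blast
    then show ?case by simp
  qed (simp add: assms)
  from this[of y] show ?thesis using assms finite_subset[of y] by (simp add: Un_absorb1)
qed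

lemma upset_iff_stable: "upset n F \<longleftrightarrow> (\<forall>i\<in>{1..n}. compr_stable {i} {} F)"
proof
  assume "\<forall>i\<in>{1..n}. compr_stable {i} {} F"
  then have "insert i x \<in> F" if "x \<in> F" "i \<in> {1..n}" for x i
    using that compr_stableD[of "{i}" "{}" F x] by (cases "i \<in> x") (auto simp: insert_absorb)
  then show "upset n F" by (simp add: upset_def)
qed (auto simp: upset_def compr_stable_def swap_def)

text \<open>Replacing \<open>x - y\<close> by one element more taken from \<open>y - x\<close>
  yields a subset of \<open>y\<close>; closure under supersets then reaches
  \<open>y\<close>.\<close>

lemma all_up_stable:
  assumes st: "\<And>U V. up_pair n U V \<Longrightarrow> compr_stable U V F" and F: "F \<subseteq> cube n"
    and x: "x \<in> F" and y: "y \<in> cube n" and less: "card x < card y"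
  shows "y \<in> F"
proof -
  have up: "upset n F" unfolding upset_iff_stable by (auto intro!: st simp: up_pair_def)
  have fin: "finite x" "finite y" using x y F finite_in_cube by blast+
  have "card (x - y) < card (y - x)"
    using less card_Int_Diff[OF fin(1), of y] card_Int_Diff[OF fin(2), of x]
    by (simp add: Int_commute)
  then obtain U where U: "U \<subseteq> y - x" "card U = Suc (card (x - y))"
    using obtain_subset_with_card_n[of "Suc (card (x - y))" "y - x"] by (metis Suc_leI)
  have "x \<subseteq> {1..n}" "y \<subseteq> {1..n}" using x y F by (auto simp: cube_def)
  then have "up_pair n U (x - y)" using U unfolding up_pair_def by blast
  moreover have "x - y \<subseteq> x" "U \<inter> x = {}" using U(1) by blast+
  ultimately have "(x - (x - y)) \<union> U \<in> F" using compr_stableD[OF st x] by metis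
  moreover have "(x - (x - y)) \<union> U \<subseteq> y" using U(1) by blast
  ultimately show ?thesis using upsetD[OF up] y by (simp add: cube_def)
qed

section \<open>Compressions within a layer and the simplicial order\<close>

definition rank :: "nat \<Rightarrow> nat set \<Rightarrow> nat" where
  "rank n A = card {B \<in> cube n. simplicial_less B A}"

lemma rank_less:
  assumes "A \<in> cube n" "B \<in> cube n" "simplicial_less A B"
  shows "rank n A < rank n B"
  unfolding rank_def
proof (rule psubset_card_mono)
  have "{X \<in> cube n. simplicial_less X A} \<subseteq> {X \<in> cube n. simplicial_less X B}"
    using assms simplicial_less_trans[of _ A B] finite_in_cube[of _ n] by (metis (no_types, lifting) Collect_mono)
  moreover have "A \<in> {X \<in> cube n. simplicial_less X B} - {X \<in> cube n. simplicial_less X A}"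
    using assms simplicial_less_irrefl by simp
  ultimately show "{X \<in> cube n. simplicial_less X A} \<subset> {X \<in> cube n. simplicial_less X B}"
    by (metis DiffE psubsetI)
qed (simp add: finite_cube)

lemma swap_level_pair:
  assumes "level_pair n U V" "V \<subseteq> x" "U \<inter> x = {}" "x \<in> cube n"
  shows "simplicial_less (swap U V x) x" "swap U V x \<in> cube n"
proof -
  have fin: "finite x" "finite U" "finite V"
    using assms finite_subset[of _ "{1..n}"] by (auto simp: level_pair_def cube_def)
  have "card (swap U V x) = card (x - V) + card U"
    unfolding swap_def using fin assms by (intro card_Un_disjoint) auto
  then have c: "card (swap U V x) = card x"
    using card_mono[OF fin(1) assms(2)] assms(1,2) fin by (simp add: card_Diff_subset level_pair_def)
  obtain m where m: "m \<in> V" "\<And>z. z \<in> U \<union> V \<Longrightarrow> z \<le> m"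
    using assms(1) unfolding level_pair_def by blast
  have "m \<in> x - swap U V x" using m assms by (auto simp: swap_def level_pair_def)
  moreover have "y \<in> swap U V x \<longleftrightarrow> y \<in> x" if "y > m" for y
    using m(2)[of y] that by (auto simp: swap_def)
  ultimately have "swap U V x \<noteq> x \<and> Max (sym_diff (swap U V x) x) \<in> x"
    using fin by (subst Max_sym_diff_in_iff) (auto simp: swap_def)
  then show "simplicial_less (swap U V x) x" using c by (simp add: simplicial_less_def)
  show "swap U V x \<in> cube n" using assms by (auto simp: swap_def level_pair_def cube_def)
qed

lemma level_pair_remove:
  assumes lp: "level_pair n U V" and u: "u \<in> U"
    and st: "\<And>U' V'. level_pair n U' V' \<Longrightarrow> card V' < card V \<Longrightarrow> compr_stable U' V' F"
  obtains v where "v \<in> V" "compr_stable (U - {u}) (V - {v}) F"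
proof -
  obtain m where m: "m \<in> V" "\<And>z. z \<in> U \<union> V \<Longrightarrow> z \<le> m"
    using lp unfolding level_pair_def by blast
  have fin: "finite U" "finite V" and sub: "U \<subseteq> {1..n}" "V \<subseteq> {1..n}" "U \<inter> V = {}" "card U = card V"
    using lp finite_subset[of _ "{1..n}"] by (auto simp: level_pair_def)
  show ?thesis
  proof (cases "V = {m}")
    case True
    then have "U = {u}" using sub(4) u by (auto simp: card_1_singleton_iff)
    then have "compr_stable (U - {u}) (V - {m}) F" using True by (simp add: compr_stable_def swap_def)
    then show ?thesis using that m(1) by blast
  next
    case False
    then obtain v where v: "v \<in> V" "v \<noteq> m" using m by blast
    have "level_pair n (U - {u}) (V - {v})"
      unfolding level_pair_def
    proof (intro conjI)
      show "card (U - {u}) = card (V - {v})" using u v fin sub(4) by simp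
      show "\<exists>m\<in>V - {v}. \<forall>z\<in>(U - {u}) \<union> (V - {v}). z \<le> m" using m v by blast
    qed (use sub in blast)+
    moreover have "card (V - {v}) < card V" using v fin by (meson card_Diff1_less)
    ultimately show ?thesis using that v st by blast
  qed
qed

text \<open>\<open>Q1\<close> comes from stability under a smaller level pair. The set in
  \<open>Q2\<close> has one element more than \<open>x\<close>, so \<open>big\<close> already places
  it in \<open>F\<close>.\<close>

lemma card_nbr_compr_level_pair:
  assumes lp: "level_pair n U V" and F: "F \<subseteq> cube n"
    and big: "\<And>x y. x \<in> F \<Longrightarrow> y \<in> cube n \<Longrightarrow> card x < card y \<Longrightarrow> y \<in> F"
    and st: "\<And>U' V'. level_pair n U' V' \<Longrightarrow> card V' < card V \<Longrightarrow> compr_stable U' V' F"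
  shows "card (nbr n (compr U V F)) \<le> card (nbr n F)"
proof -
  have fin: "finite U" "finite V" and UV: "U \<subseteq> {1..n}" "V \<subseteq> {1..n}" "U \<inter> V = {}" "card U = card V" "V \<noteq> {}"
    using lp finite_subset[of _ "{1..n}"] by (auto simp: level_pair_def)
  have U0: "U \<noteq> {}" using UV fin by auto
  show ?thesis
  proof (rule card_nbr_compr_le[OF UV(3)], rule nbr_compr[OF UV(3) U0 UV(1,2) F])
    show "(x - V) \<union> (U - {u}) \<in> nbr n F"
      if "u \<in> U" "x \<in> F" "V \<subseteq> x" "(U - {u}) \<inter> x = {}" for u x
    proof -
      obtain v where v: "v \<in> V" "compr_stable (U - {u}) (V - {v}) F"
        using level_pair_remove[where F = F, OF lp \<open>u \<in> U\<close>] st by blast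
      have "(x - (V - {v})) \<union> (U - {u}) \<in> F"
        using that by (intro compr_stableD[OF v(2)]) auto
      moreover have "((x - (V - {v})) \<union> (U - {u})) - {v} = (x - V) \<union> (U - {u})"
        using v UV(3) by blast
      ultimately show ?thesis using nbr_removeI[OF _ F] by metis
    qed
    show "(x - (V - {v})) \<union> U \<in> nbr n F"
      if "v \<in> V" "x \<in> F" "V - {v} \<subseteq> x" "U \<inter> x = {}" for v x
    proof -
      have x: "x \<in> cube n" "finite x" using that F finite_in_cube by blast+
      have "card ((x - (V - {v})) \<union> U) = card (x - (V - {v})) + card U"
        using x that fin by (intro card_Un_disjoint) auto
      also have "card (x - (V - {v})) = card x - (card V - 1)"
        using that fin by (simp add: card_Diff_subset)
      also have "card x - (card V - 1) + card U = Suc (card x)"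
        using card_mono[OF x(2) that(3)] that(1) fin UV(4) card_gt_0_iff[of V] by auto
      finally have "card x < card ((x - (V - {v})) \<union> U)" by simp
      then have "(x - (V - {v})) \<union> U \<in> F"
        using x that UV by (intro big[OF that(2)]) (auto simp: cube_def)
      then show ?thesis using nbr_self[OF F] by blast
    qed
  qed
qed

text \<open>A competitor of the same size with least total rank is stable under both kinds of compression.
  Compressions within a layer are only needed once all sets larger than some member are present.\<close>

theorem harper:
  assumes A: "A \<subseteq> cube n"
  shows "card (nbr n (initial_segment n (card A))) \<le> card (nbr n A)"
proof -
  define P where "P B \<longleftrightarrow> B \<subseteq> cube n \<and> card B = card A \<and> card (nbr n B) \<le> card (nbr n A)" for B
  have "\<exists>F. P F \<and> (\<forall>B. P B \<longrightarrow> sum (rank n) F \<le> sum (rank n) B)"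
    by (rule ex_has_least_nat[of _ A]) (simp add: P_def A)
  then obtain F where PF: "P F" and min: "\<And>B. P B \<Longrightarrow> sum (rank n) F \<le> sum (rank n) B" by blast
  have F: "F \<subseteq> cube n" "card F = card A" "card (nbr n F) \<le> card (nbr n A)"
    using PF by (auto simp: P_def)
  have finF: "finite F" using F(1) finite_cube finite_subset by blast
  \<comment> \<open>A compression that lowers ranks without enlarging the neighbourhood would beat
    the minimal \<open>F\<close>.\<close>
  have contra: False if UV: "U \<inter> V = {}" "U \<subseteq> {1..n}" and ns: "\<not> compr_stable U V F"
    and le: "card (nbr n (compr U V F)) \<le> card (nbr n F)"
    and less: "\<And>x. x \<in> F \<Longrightarrow> V \<subseteq> x \<Longrightarrow> U \<inter> x = {} \<Longrightarrow> rank n (swap U V x) < rank n x" for U V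
  proof -
    have "sum (rank n) (compr U V F) < sum (rank n) F"
      using less by (intro sum_compr_less[OF UV(1) finF ns])
    moreover have "P (compr U V F)"
      unfolding P_def using compr_cube[OF UV F(1)] card_compr[OF UV(1)] F le by simp
    ultimately show False using min by (meson not_le)
  qed
  have up: "compr_stable U V F" if "up_pair n U V" for U V
  proof (rule ccontr)
    assume "\<not> compr_stable U V F"
    with that obtain U V where UV: "up_pair n U V" "\<not> compr_stable U V F"
      "\<And>u v. u \<in> U \<Longrightarrow> v \<in> V \<Longrightarrow> compr_stable (U - {u}) (V - {v}) F"
      using minimal_unstable_up_pair by metis
    show False
    proof (rule contra[OF _ _ UV(2)])
      show "rank n (swap U V x) < rank n x" if "x \<in> F" "V \<subseteq> x" "U \<inter> x = {}" for x
        using card_swap_up_pair[OF UV(1) that(2,3)] that(1) F(1)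
        by (intro rank_less) (auto simp: simplicial_less_def)
    qed (use UV card_nbr_compr_up_pair[OF UV(1) F(1)] in \<open>auto simp: up_pair_def\<close>)
  qed
  note big = all_up_stable[OF up F(1)]
  have level: "compr_stable U V F" if "level_pair n U V" for U V
    using that
  proof (induction "card V" arbitrary: U V rule: less_induct)
    case less
    show ?case
    proof (rule ccontr)
      assume ns: "\<not> compr_stable U V F"
      show False
      proof (rule contra[OF _ _ ns])
        show "card (nbr n (compr U V F)) \<le> card (nbr n F)"
          by (rule card_nbr_compr_level_pair[OF less.prems F(1) big less.hyps])
        show "rank n (swap U V x) < rank n x" if "x \<in> F" "V \<subseteq> x" "U \<inter> x = {}" for x
          using swap_level_pair[OF less.prems that(2,3)] that(1) F(1) by (intro rank_less) auto
      qed (use less.prems in \<open>auto simp: level_pair_def\<close>)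
    qed
  qed
  have "F = initial_segment n (card F)"
  proof (rule initial_segment_unique[OF F(1) refl])
    fix x y assume x: "x \<in> F" and y: "y \<in> cube n" and yx: "simplicial_less y x"
    show "y \<in> F"
    proof (cases "card y > card x")
      case True
      then show ?thesis using big x y by blast
    next
      case False
      then have c: "card y = card x" "y \<noteq> x \<and> Max (sym_diff y x) \<in> x"
        using yx by (auto simp: simplicial_less_def)
      have fin: "finite x" "finite y" using x y F finite_in_cube by blast+
      obtain m where m: "m \<in> x - y" "\<forall>z>m. z \<in> y \<longleftrightarrow> z \<in> x"
        using c(2) unfolding Max_sym_diff_in_iff[OF fin(2,1)] by blast
      \<comment> \<open>Exchanging \<open>x - y\<close> for \<open>y - x\<close> turns
        \<open>x\<close> into \<open>y\<close>, and the largest point of difference lies in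
        \<open>x\<close>; hence one stable compression leads from \<open>x\<close> to
        \<open>y\<close>.\<close>
      have "level_pair n (y - x) (x - y)"
        unfolding level_pair_def
      proof (intro conjI)
        show "card (y - x) = card (x - y)"
          using c(1) card_Int_Diff[OF fin(1), of y] card_Int_Diff[OF fin(2), of x]
          by (simp add: Int_commute)
        show "\<exists>m\<in>x - y. \<forall>z\<in>(y - x) \<union> (x - y). z \<le> m"
          using m by (intro bexI[of _ m]) (auto simp: not_le[symmetric])
      qed (use x y F(1) in \<open>auto simp: cube_def\<close>)
      then have "(x - (x - y)) \<union> (y - x) \<in> F" using x by (intro compr_stableD[OF level]) auto
      moreover have "(x - (x - y)) \<union> (y - x) = y" by blast
      ultimately show ?thesis by simp
    qed
  qed
  then show ?thesis using F by simp
qed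

section \<open>Lovasz's form of the Kruskal--Katona theorem\<close>

definition shadow :: "'a set set \<Rightarrow> 'a set set" where
  "shadow F = {x - {a} | x a. x \<in> F \<and> a \<in> x}"

lemma shadowI: "x \<in> F \<Longrightarrow> a \<in> x \<Longrightarrow> x - {a} \<in> shadow F"
  by (auto simp: shadow_def)

lemma finite_shadow:
  assumes "finite F" "\<And>x. x \<in> F \<Longrightarrow> finite x"
  shows "finite (shadow F)"
proof -
  have "shadow F = (\<Union>x\<in>F. (\<lambda>a. x - {a}) ` x)" by (auto simp: shadow_def)
  then show ?thesis using assms by auto
qed

text \<open>Removing an element other than \<open>i\<close> and \<open>j\<close> commutes with the
  shift. After removing \<open>i\<close> or \<open>j\<close>, the set, and its shifted partner where
  one is required, already lies in \<open>shadow F\<close>.\<close>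

lemma shadow_compr:
  assumes ij: "i \<noteq> j"
  shows "shadow (compr {i} {j} F) \<subseteq> compr {i} {j} (shadow F)"
proof
  fix y assume "y \<in> shadow (compr {i} {j} F)"
  then obtain z a where z: "z \<in> compr {i} {j} F" "a \<in> z" and y: "y = z - {a}"
    by (auto simp: shadow_def)
  consider "a \<noteq> i" "a \<noteq> j" | "a = i" | "a = j" by blast
  then show "y \<in> compr {i} {j} (shadow F)"
  proof cases
    case 1
    then have *: "swap {i} {j} y = swap {i} {j} z - {a}" "swap {j} {i} y = swap {j} {i} z - {a}"
      "a \<in> swap {i} {j} z" "a \<in> swap {j} {i} z"
      using z(2) y by (auto simp: swap_def)
    have "i \<in> y \<longleftrightarrow> i \<in> z" "j \<in> y \<longleftrightarrow> j \<in> z" using 1 y by auto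
    then show ?thesis
      using z(1) shadowI[OF _ z(2), of F] shadowI[OF _ *(3), of F] shadowI[OF _ *(4), of F]
      unfolding compr_def mem_Collect_eq *(1,2) y[symmetric] by (auto split: if_splits)
  next
    case 2
    show ?thesis
    proof (cases "z \<in> F")
      case True
      have "swap {i} {j} y \<in> shadow F" if "j \<in> y"
      proof -
        have "swap {i} {j} y = z - {j}" using 2 z(2) y ij by (auto simp: swap_def)
        then show ?thesis using shadowI[OF True, of j] that y by simp
      qed
      then show ?thesis using shadowI[OF True z(2)] y by (auto simp: compr_def)
    next
      case False
      then obtain x where x: "x \<in> F" "z = swap {i} {j} x" "j \<in> x" "i \<notin> x"
        using compr_sub[OF _ z(1)] ij by auto
      have "y = x - {j}" using x 2 y by (auto simp: swap_def)
      then show ?thesis using shadowI[OF x(1,3)] 2 y by (auto simp: compr_def)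
    qed
  next
    case 3
    then have zF: "z \<in> F" "i \<notin> z \<Longrightarrow> swap {i} {j} z \<in> F"
      using z by (auto simp: compr_def split: if_splits)
    show ?thesis using shadowI[OF zF(1) z(2)] 3 y by (auto simp: compr_def)
  qed
qed

text \<open>Among families of the same size and uniformity with no larger shadow, one with the
  fewest members avoiding \<open>i\<close> admits no further effective shift towards
  \<open>i\<close>.\<close>

lemma shift_to_element:
  fixes F :: "'a set set" and i :: 'a
  assumes "finite F" "\<And>x. x \<in> F \<Longrightarrow> finite x \<and> card x = r"
  obtains G where "finite G" "card G = card F" "\<And>x. x \<in> G \<Longrightarrow> finite x \<and> card x = r"
    "card (shadow G) \<le> card (shadow F)"
    "\<And>x j. x \<in> G \<Longrightarrow> j \<in> x \<Longrightarrow> i \<notin> x \<Longrightarrow> insert i (x - {j}) \<in> G"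
proof -
  define P where "P G \<longleftrightarrow> finite G \<and> card G = card F \<and> (\<forall>x\<in>G. finite x \<and> card x = r) \<and>
    card (shadow G) \<le> card (shadow F)" for G :: "'a set set"
  define w where "w x = (if i \<in> x then 0 else 1 :: nat)" for x :: "'a set"
  have "\<exists>G. P G \<and> (\<forall>B. P B \<longrightarrow> sum w G \<le> sum w B)"
    by (rule ex_has_least_nat[of _ F]) (simp add: P_def assms)
  then obtain G where PG: "P G" and min: "\<And>B. P B \<Longrightarrow> sum w G \<le> sum w B" by blast
  have G: "finite G" "card G = card F" "\<And>x. x \<in> G \<Longrightarrow> finite x \<and> card x = r"
    "card (shadow G) \<le> card (shadow F)" using PG by (auto simp: P_def)
  have st: "compr_stable {i} {j} G" if "i \<noteq> j" for j
  proof (rule ccontr)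
    assume ns: "\<not> compr_stable {i} {j} G"
    have d: "{i} \<inter> {j} = {}" using that by simp
    have "sum w (compr {i} {j} G) < sum w G"
      by (rule sum_compr_less[OF d G(1) ns]) (auto simp: w_def swap_def)
    moreover have "P (compr {i} {j} G)"
      unfolding P_def
    proof (intro conjI ballI)
      fix x assume "x \<in> compr {i} {j} G"
      then consider "x \<in> G" | y where "y \<in> G" "x = swap {i} {j} y" "j \<in> y" "i \<notin> y"
        using compr_sub[OF d] by auto
      then have "finite x \<and> card x = r"
      proof cases
        case 2
        then have "finite y" "card y = r" using G(3) by auto
        moreover have "card y > 0" using 2 \<open>finite y\<close> card_gt_0_iff by blast
        ultimately show ?thesis using 2 by (simp add: swap_def)
      qed (use G(3) in auto)
      then show "finite x" "card x = r" by auto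
    next
      have "card (shadow (compr {i} {j} G)) \<le> card (compr {i} {j} (shadow G))"
        using G by (intro card_mono finite_compr[OF d] finite_shadow shadow_compr[OF that]) auto
      then show "card (shadow (compr {i} {j} G)) \<le> card (shadow F)"
        using G(4) card_compr[OF d, of "shadow G"] by simp
    qed (use G finite_compr[OF d] card_compr[OF d] in auto)
    ultimately show False using min by (meson not_le)
  qed
  show ?thesis
  proof (rule that[OF G])
    fix x j assume "x \<in> G" "j \<in> x" "i \<notin> x"
    then show "insert i (x - {j}) \<in> G" using compr_stableD[OF st, of j x] by auto
  qed
qed

text \<open>For positive \<open>k\<close> the smallest factor in the numerator is
  \<open>x - (k - 1)\<close>, whence the bound \<open>x + 1\<close>.\<close>

lemma gbinomial_nonneg: "real k \<le> x + 1 \<Longrightarrow> 0 \<le> x gchoose k"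
  unfolding gbinomial_prod_rev by (intro divide_nonneg_nonneg prod_nonneg) auto

text \<open>Frankl's argument: after shifting to an element \<open>i\<close>, the link \<open>G1\<close> of \<open>i\<close> contains the shadow of the
  part \<open>G0\<close> avoiding \<open>i\<close>.\<close>

theorem lovasz_shadow:
  fixes F :: "'a set set" and x :: real
  assumes "finite F" "\<And>A. A \<in> F \<Longrightarrow> finite A \<and> card A = Suc r"
    and "real (Suc r) \<le> x" "x gchoose Suc r \<le> real (card F)"
  shows "x gchoose r \<le> real (card (shadow F))"
  using assms
proof (induction "r + card F" arbitrary: r F x rule: less_induct)
  case less
  have "0 < x gchoose Suc r"
    using gbinomial_mono[of "Suc r" "real (Suc r)" x] less.prems(3)
    by (simp add: gbinomial_of_nat_symmetric[of "Suc r" "Suc r"] del: of_nat_Suc)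
  then have F0: "F \<noteq> {}" using less.prems(4) by auto
  \<comment> \<open>An arbitrary element serves: shifting towards it forces some member of
    \<open>G\<close> to contain it, as shown for \<open>G1\<close> below.\<close>
  define i :: 'a where "i = undefined"
  obtain G where G: "finite G" "card G = card F" "\<And>A. A \<in> G \<Longrightarrow> finite A \<and> card A = Suc r"
    "card (shadow G) \<le> card (shadow F)"
    "\<And>A j. A \<in> G \<Longrightarrow> j \<in> A \<Longrightarrow> i \<notin> A \<Longrightarrow> insert i (A - {j}) \<in> G"
    using shift_to_element[OF less.prems(1,2)] by metis
  define G1 where "G1 = {A. i \<notin> A \<and> insert i A \<in> G}"
  define G0 where "G0 = {A \<in> G. i \<notin> A}"
  have G1_img: "insert i ` G1 = {A \<in> G. i \<in> A}"
  proof
    show "{A \<in> G. i \<in> A} \<subseteq> insert i ` G1"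
    proof
      fix A assume "A \<in> {A \<in> G. i \<in> A}"
      then show "A \<in> insert i ` G1"
        by (intro image_eqI[of _ _ "A - {i}"]) (auto simp: G1_def insert_absorb)
    qed
  qed (auto simp: G1_def)
  have inj: "inj_on (insert i) H" if "\<And>A. A \<in> H \<Longrightarrow> i \<notin> A" for H
  proof (rule inj_onI)
    fix A B assume "A \<in> H" "B \<in> H" "insert i A = insert i B"
    then show "A = B" using that[of A] that[of B] insert_ident[of i A B] by simp
  qed
  have i1: "i \<notin> A" if "A \<in> G1" for A using that by (simp add: G1_def)
  have "finite (insert i ` G1)" unfolding G1_img using G(1) by simp
  then have fin1: "finite G1" by (rule finite_imageD[OF _ inj[OF i1]])
  have fin0: "finite G0" using G(1) by (simp add: G0_def)
  have "G = {A \<in> G. i \<in> A} \<union> G0" "{A \<in> G. i \<in> A} \<inter> G0 = {}" by (auto simp: G0_def)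
  then have cardG: "card G = card G1 + card G0"
    using card_Un_disjoint[of "{A \<in> G. i \<in> A}" G0] G(1) fin0 card_image[OF inj[OF i1], of G1]
    unfolding G1_img by simp
  have c1: "finite A \<and> card A = r" if "A \<in> G1" for A
    using that G(3)[of "insert i A"] by (auto simp: G1_def)
  have c0: "finite A \<and> card A = Suc r" if "A \<in> G0" for A
    using that G(3) by (auto simp: G0_def)
  have sh0: "shadow G0 \<subseteq> G1"
    using G(5) by (auto simp: shadow_def G0_def G1_def)
  obtain A where A: "A \<in> G" using F0 G(1,2) less.prems(1) by fastforce
  have "G1 \<noteq> {}"
  proof (cases "i \<in> A")
    case True
    then have "A - {i} \<in> G1" using A by (simp add: G1_def insert_absorb)
    then show ?thesis by blast
  next
    case False
    have "A \<noteq> {}" using G(3)[OF A] by auto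
    then obtain j where "j \<in> A" by blast
    then have "A - {j} \<in> G1" using False G(5)[OF A] by (simp add: G1_def)
    then show ?thesis by blast
  qed
  then have lt0: "card G0 < card F" using cardG G(2) fin1 by (simp add: card_gt_0_iff)
  have finS: "finite (shadow G)" using G(1,3) by (intro finite_shadow) auto
  \<comment> \<open>In the shadow of \<open>G\<close>, removing \<open>i\<close> produces
    \<open>G1\<close>, and removing another element from a set through \<open>i\<close> produces the
    sets \<open>insert i B\<close> with \<open>B\<close> in \<open>shadow G1\<close>.\<close>
  have lower: "card G1 + card (shadow G1) \<le> card (shadow G)"
  proof -
    have "G1 \<subseteq> shadow G"
    proof
      fix A assume "A \<in> G1"
      then show "A \<in> shadow G" using shadowI[of "insert i A" G i] by (simp add: G1_def)
    qed
    moreover have "insert i ` shadow G1 \<subseteq> shadow G"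
    proof
      fix B assume "B \<in> insert i ` shadow G1"
      then obtain A a where A: "A \<in> G1" "a \<in> A" "B = insert i (A - {a})" by (auto simp: shadow_def)
      then have "a \<noteq> i" "B = insert i A - {a}" by (auto simp: G1_def)
      then show "B \<in> shadow G" using shadowI[of "insert i A" G a] A by (auto simp: G1_def)
    qed
    moreover have "G1 \<inter> insert i ` shadow G1 = {}" by (auto simp: G1_def)
    moreover have "card (insert i ` shadow G1) = card (shadow G1)"
      by (rule card_image[OF inj]) (auto simp: shadow_def G1_def)
    moreover have "finite (insert i ` shadow G1)" using finS calculation(2) finite_subset by blast
    ultimately show ?thesis using finS fin1
      by (metis Un_subset_iff card_Un_disjoint card_mono)
  qed
  \<comment> \<open>If \<open>G1\<close> were too small, Pascal's rule would make \<open>G0\<close>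
    large; by induction its shadow would then outnumber \<open>G1\<close>, which contains
    it.\<close>
  have G1big: "(x - 1) gchoose r \<le> real (card G1)"
  proof (rule ccontr)
    assume "\<not> ?thesis"
    then have *: "real (card G1) < (x - 1) gchoose r" by simp
    then have c0gt: "(x - 1) gchoose Suc r < real (card G0)"
      using less.prems(4) cardG G(2) gbinomial_addition_formula[of x r] by simp
    \<comment> \<open>\<open>x - 1\<close> may fall below the range of the induction hypothesis. It
      is then raised to \<open>Suc r\<close>, where the binomial is 1 and a nonempty
      \<open>G0\<close> suffices.\<close>
    define x' where "x' = max (x - 1) (real (Suc r))"
    have "0 < card G0"
      using c0gt gbinomial_nonneg[of "Suc r" "x - 1"] less.prems(3) by linarith
    then have "x' gchoose Suc r \<le> real (card G0)"
      using c0gt gbinomial_of_nat_symmetric[of "Suc r" "Suc r", where 'a = real]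
      by (auto simp: x'_def max_def simp del: of_nat_Suc)
    then have "x' gchoose r \<le> real (card (shadow G0))"
      using lt0 c0 fin0 by (intro less.hyps) (auto simp: x'_def)
    also have "\<dots> \<le> real (card G1)" using sh0 fin1 card_mono by auto
    also have "\<dots> < (x - 1) gchoose r" by (rule *)
    also have "\<dots> \<le> x' gchoose r"
      using less.prems(3) by (intro gbinomial_mono) (auto simp: x'_def)
    finally show False by simp
  qed
  have "x gchoose r \<le> real (card (shadow G))"
  proof (cases r)
    case 0
    have "G1 \<noteq> {}" by fact
    then show ?thesis using 0 lower fin1 card_gt_0_iff[of G1] by auto
  next
    case (Suc s)
    have "(x - 1) gchoose s \<le> real (card (shadow G1))"
      using Suc c1 fin1 less.prems(3) G1big cardG G(2) by (intro less.hyps) auto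
    then show ?thesis
      using G1big lower gbinomial_addition_formula[of x s] Suc by simp
  qed
  then show ?case using G(4) by linarith
qed

text \<open>Write \<open>card F\<close> as a binomial with real upper entry
  \<open>x \<le> N\<close>; consecutive binomials have ratio \<open>(r + 1) / (x - r)\<close>. A
  family of at most half the full size pushes \<open>x\<close> far enough below \<open>N\<close> to
  gain the extra \<open>1 / 2\<close>.\<close>

lemma shadow_ratio:
  fixes F :: "'a set set"
  assumes F: "finite F" "\<And>A. A \<in> F \<Longrightarrow> finite A \<and> card A = Suc r" "F \<noteq> {}"
    and N: "Suc r \<le> N" "card F \<le> N choose Suc r"
  shows "real (Suc r) * real (card F) \<le> (real N - real r) * real (card (shadow F))"
    and "2 * card F \<le> N choose Suc r \<Longrightarrow>
      (real (Suc r) + 1 / 2) * real (card F) \<le> (real N - real r) * real (card (shadow F))"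
proof -
  have "\<exists>x. real (Suc r) \<le> x \<and> x \<le> real N \<and> x gchoose Suc r = real (card F)"
  proof (rule IVT')
    show "real (Suc r) gchoose Suc r \<le> real (card F)"
      using F by (simp add: gbinomial_of_nat_symmetric[of "Suc r" "Suc r"] Suc_le_eq card_gt_0_iff del: of_nat_Suc)
    show "real (card F) \<le> real N gchoose Suc r"
      using N by (simp flip: binomial_gbinomial)
    show "continuous_on {real (Suc r)..real N} (\<lambda>x. x gchoose Suc r)"
      unfolding gbinomial_prod_rev by (intro continuous_intros) auto
  qed (use N in simp)
  then obtain x where x: "real (Suc r) \<le> x" "x \<le> real N" "x gchoose Suc r = real (card F)" by blast
  let ?D = "real (card F)" and ?S = "real (card (shadow F))"
  have D0: "?D > 0" using F by (simp add: card_gt_0_iff)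
  have "x gchoose r \<le> ?S" using lovasz_shadow[OF F(1,2) x(1)] x(3) by simp
  moreover have "real (Suc r) * ?D = (x - real r) * (x gchoose r)"
    using gbinomial_absorption[of r x] gbinomial_absorb_comp[of x r] x(3) by simp
  ultimately have *: "real (Suc r) * ?D \<le> (x - real r) * ?S"
    using x(1) by (simp add: mult_left_mono)
  show 1: "real (Suc r) * ?D \<le> (real N - real r) * ?S"
    using * mult_right_mono[of "x - real r" "real N - real r" ?S] x(2) by linarith
  assume half: "2 * card F \<le> N choose Suc r"
  \<comment> \<open>Chosen so that \<open>N - r = (1 + y) * (x - r)\<close>. Every other factor of
    the binomial grows by at most this ratio, so doubling it forces
    \<open>(1 + y) ^ Suc r \<ge> 2\<close>.\<close>
  define y where "y = (real N - x) / (x - real r)"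
  have xr: "x - real r \<ge> 1" using x(1) by simp
  have y0: "y \<ge> 0" using x xr by (simp add: y_def)
  have fact: "real N - real i \<le> (1 + y) * (x - real i)" if "i \<le> r" for i
  proof -
    have "(real N - x) * 1 \<le> (real N - x) * ((x - real i) / (x - real r))"
      using that x xr by (intro mult_left_mono) (auto simp: le_divide_eq)
    then show ?thesis by (simp add: y_def algebra_simps)
  qed
  have "2 * ?D \<le> real N gchoose Suc r"
    using half by (simp flip: binomial_gbinomial)
  also have "\<dots> \<le> (1 + y) ^ Suc r * (x gchoose Suc r)"
  proof -
    have "(\<Prod>i = 0..<Suc r. real N - real i) \<le> (\<Prod>i = 0..<Suc r. (1 + y) * (x - real i))"
      using fact N(1) by (intro prod_mono) auto
    then have "(\<Prod>i = 0..<Suc r. real N - real i) \<le> (1 + y) ^ Suc r * (\<Prod>i = 0..<Suc r. x - real i)"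
      by (simp only: prod.distrib prod_constant card_atLeastLessThan diff_zero)
    then show ?thesis unfolding gbinomial_prod_rev
      by (simp add: divide_right_mono)
  qed
  finally have "2 \<le> (1 + y) ^ Suc r" using D0 x(3) by simp
  also have "\<dots> \<le> exp y ^ Suc r" using y0 exp_ge_add_one_self[of y] by (intro power_mono) auto
  also have "\<dots> = exp (real (Suc r) * y)" by (rule exp_of_nat_mult[symmetric])
  \<comment> \<open>The gain \<open>1 / 2\<close> originates in
    \<open>exp (1 / 2) \<le> 2\<close>.\<close>
  finally have "exp (1 / 2) \<le> exp (real (Suc r) * y)" using exp_half_le2 by linarith
  then have ry: "1 / 2 \<le> real (Suc r) * y" by simp
  have NX: "real N - real r = (1 + y) * (x - real r)" using xr by (simp add: y_def field_simps)
  have "(real (Suc r) + 1 / 2) * ?D \<le> (1 + y) * (real (Suc r) * ?D)"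
    using mult_right_mono[OF ry, of ?D] D0 by (simp add: algebra_simps)
  also have "\<dots> \<le> (1 + y) * ((x - real r) * ?S)" using * y0 by (intro mult_left_mono) auto
  finally show "(real (Suc r) + 1 / 2) * ?D \<le> (real N - real r) * ?S" by (simp only: NX mult.assoc)
qed

section \<open>Families close to a union of top layers\<close>

lemma card_level: "card {x \<in> cube n. card x = j} = n choose j"
  using n_subsets[of "{1..n}" j] by (simp add: cube_def)

lemma card_level_avoid:
  assumes "1 \<le> n"
  shows "card {x \<in> cube n. n \<notin> x \<and> card x = j} = (n - 1) choose j"
proof -
  have "{x \<in> cube n. n \<notin> x \<and> card x = j} = {x. x \<subseteq> {1..n} - {n} \<and> card x = j}"
    unfolding cube_def by blast
  also have "card \<dots> = card ({1..n} - {n}) choose j" by (rule n_subsets) simp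
  also have "card ({1..n} - {n}) = n - 1" using assms by simp
  finally show ?thesis .
qed

lemma initial_segment_mono: "a \<le> b \<Longrightarrow> initial_segment n a \<subseteq> initial_segment n b"
  by (auto simp: initial_segment_def)

lemma initial_segment_cube: "initial_segment n a \<subseteq> cube n"
  by (auto simp: initial_segment_def)

lemma extend_in_cube:
  assumes "y \<in> cube n" "S \<subseteq> {1..n}" "card y < card S"
  obtains i where "i \<in> S" "i \<notin> y" "insert i y \<in> cube n" "card (insert i y) = Suc (card y)"
proof -
  have "\<not> S \<subseteq> y" using assms finite_in_cube[OF assms(1)] card_mono[of y S] by fastforce
  then obtain i where "i \<in> S" "i \<notin> y" by blast
  then show ?thesis using assms finite_in_cube[OF assms(1)] by (intro that) (auto simp: cube_def)
qed

text \<open>These are the initial segments of sizes \<open>m - M\<close> (for \<open>j = k\<close>) and \<open>m + M\<close> (for \<open>j = k - 1\<close>), with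
  \<open>m\<close> and \<open>M\<close> as in the locale \<open>layers\<close> below.\<close>

definition colex_layer :: "nat \<Rightarrow> nat \<Rightarrow> nat set set" where
  "colex_layer n j = {x \<in> cube n. j < card x \<or> (card x = j \<and> n \<notin> x)}"

text \<open>The coordinate \<open>n\<close> is the largest, so within a layer the sets containing it
  come after all the others.\<close>

lemma colex_layer_eq_initial_segment:
  "colex_layer n j = initial_segment n (card (colex_layer n j))"
proof (rule initial_segment_unique[OF _ refl])
  fix x y assume x: "x \<in> colex_layer n j" and y: "y \<in> cube n" and less: "simplicial_less y x"
  show "y \<in> colex_layer n j"
  proof (cases "card x < card y")
    case True
    then show ?thesis using x y by (auto simp: colex_layer_def)
  next
    case False
    then have c: "card y = card x" "y \<noteq> x \<and> Max (sym_diff y x) \<in> x"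
      using less by (auto simp: simplicial_less_def)
    have fin: "finite x" "finite y" using x y finite_in_cube by (auto simp: colex_layer_def)
    obtain m where m: "m \<in> x - y" "\<forall>z>m. z \<in> y \<longleftrightarrow> z \<in> x"
      using c(2) unfolding Max_sym_diff_in_iff[OF fin(2,1)] by blast
    have "m \<le> n" using m(1) x by (auto simp: colex_layer_def cube_def)
    then have "n \<in> y \<Longrightarrow> n \<in> x" using m by (cases "m = n") auto
    then show ?thesis using c(1) x y by (auto simp: colex_layer_def)
  qed
qed (auto simp: colex_layer_def)

locale layers =
  fixes n k :: nat
  assumes k1: "1 \<le> k" and kn: "k \<le> n"
begin

definition H :: "nat set set" where "H = {x \<in> cube n. k \<le> card x}"
definition m :: nat where "m = card H"
text \<open>This counts both the \<open>k\<close>-sets containing \<open>n\<close> and the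
  \<open>(k - 1)\<close>-sets avoiding \<open>n\<close>. For \<open>D \<le> M\<close> the segments
  of sizes \<open>m - D\<close> and \<open>m + D\<close> therefore differ from \<open>H\<close> only
  in these half-layers.\<close>

definition M :: nat where "M = (n - 1) choose (k - 1)"

lemma n1: "1 \<le> n" using k1 kn by simp

lemma H_cube: "H \<subseteq> cube n" by (auto simp: H_def)

lemma finite_H: "finite H" using H_cube finite_cube finite_subset by blast

lemma initial_segment_m: "initial_segment n m = H"
  unfolding m_def
proof (rule initial_segment_unique[symmetric, OF H_cube refl])
  fix A B assume "A \<in> H" "B \<in> cube n" "simplicial_less B A"
  then show "B \<in> H" by (auto simp: H_def simplicial_less_def)
qed

lemma card_colex_layer_low: "card (colex_layer n k) + M = m"
proof -
  let ?L = "{x \<in> cube n. n \<in> x \<and> card x = k}"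
  have 1: "H = colex_layer n k \<union> ?L"
    by (auto simp: H_def colex_layer_def)
  have 2: "colex_layer n k \<inter> ?L = {}" by (auto simp: colex_layer_def)
  have 3: "{x \<in> cube n. card x = k} = {x \<in> cube n. n \<notin> x \<and> card x = k} \<union> ?L"
    "{x \<in> cube n. n \<notin> x \<and> card x = k} \<inter> ?L = {}" by auto
  have "n choose k = card {x \<in> cube n. n \<notin> x \<and> card x = k} + card ?L"
    unfolding card_level[symmetric] 3(1) by (rule card_Un_disjoint[OF _ _ 3(2)]) (simp_all add: finite_cube)
  then have "n choose k = ((n - 1) choose k) + card ?L" by (simp add: card_level_avoid[OF n1])
  moreover have "n choose k = ((n - 1) choose k) + M"
    using binomial_addition_formula[of n "k - 1"] k1 n1 by (simp add: M_def)
  ultimately have "card ?L = M" by simp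
  moreover have "card H = card (colex_layer n k) + card ?L"
    using card_Un_disjoint[OF _ _ 2] finite_H 1 by simp
  ultimately show ?thesis by (simp add: m_def)
qed

lemma card_colex_layer_high: "card (colex_layer n (k - 1)) = m + M"
proof -
  let ?L = "{x \<in> cube n. n \<notin> x \<and> card x = k - 1}"
  have 1: "colex_layer n (k - 1) = H \<union> ?L" "H \<inter> ?L = {}"
    using k1 by (auto simp: H_def colex_layer_def)
  show ?thesis unfolding 1(1) m_def M_def card_level_avoid[OF n1, symmetric]
    by (rule card_Un_disjoint[OF finite_H _ 1(2)]) (simp add: finite_cube)
qed

lemma m_M_le: "m + M \<le> 2 ^ n"
proof -
  have "card (colex_layer n (k - 1)) \<le> card (cube n)"
    by (rule card_mono[OF finite_cube]) (auto simp: colex_layer_def)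
  then show ?thesis unfolding card_colex_layer_high card_cube .
qed

definition lower_seg :: "nat \<Rightarrow> nat set set" where "lower_seg D = initial_segment n (m - D)"
definition upper_seg :: "nat \<Rightarrow> nat set set" where "upper_seg D = initial_segment n (m + D)"

lemma lower_seg:
  assumes "D \<le> M"
  shows "colex_layer n k \<subseteq> lower_seg D" "lower_seg D \<subseteq> H" "card (lower_seg D) = m - D"
proof -
  have "card (colex_layer n k) \<le> m - D" using card_colex_layer_low assms by simp
  then show "colex_layer n k \<subseteq> lower_seg D"
    using colex_layer_eq_initial_segment[of n k] initial_segment_mono unfolding lower_seg_def by metis
  show "lower_seg D \<subseteq> H"
    using initial_segment_mono[of "m - D" m n] initial_segment_m unfolding lower_seg_def by simp
  show "card (lower_seg D) = m - D"
    unfolding lower_seg_def using m_M_le by (intro card_initial_segment) simp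
qed

lemma upper_seg:
  assumes "D \<le> M"
  shows "upper_seg D \<subseteq> colex_layer n (k - 1)" "H \<subseteq> upper_seg D" "card (upper_seg D) = m + D"
proof -
  have "m + D \<le> card (colex_layer n (k - 1))" using card_colex_layer_high assms by simp
  then show "upper_seg D \<subseteq> colex_layer n (k - 1)"
    using colex_layer_eq_initial_segment[of n "k - 1"] initial_segment_mono unfolding upper_seg_def by metis
  show "H \<subseteq> upper_seg D"
    using initial_segment_mono[of m "m + D" n] initial_segment_m unfolding upper_seg_def by simp
  show "card (upper_seg D) = m + D"
    unfolding upper_seg_def using m_M_le assms by (intro card_initial_segment) simp
qed

lemma upper_seg_minus_H:
  assumes "D \<le> M" "x \<in> upper_seg D - H"
  shows "x \<in> cube n" "card x = k - 1" "n \<notin> x"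
  using upper_seg(1)[OF assms(1)] assms(2) k1 by (auto simp: colex_layer_def H_def)

lemma finite_upper_seg: "finite (upper_seg D)"
  unfolding upper_seg_def using initial_segment_cube finite_cube finite_subset by metis

lemma card_upper_seg_minus_H: "D \<le> M \<Longrightarrow> card (upper_seg D - H) = D"
  using upper_seg[of D] by (subst card_Diff_subset[OF finite_H]) (auto simp: m_def)

section \<open>Neighbourhoods near the ball \<open>H\<close> and the sharp bound\<close>

lemma nbr_H: "nbr n H = {y \<in> cube n. k - 1 \<le> card y}"
proof (intro equalityI subsetI)
  fix y assume y: "y \<in> nbr n H"
  then have "y \<in> cube n" using nbr_cube by blast
  moreover have "k - 1 \<le> card y" using y
  proof (cases rule: nbrE)
    case (remove i)
    then have "k \<le> card (y - {i})" by (simp only: H_def mem_Collect_eq)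
    then show ?thesis using card_Diff1_le[of y i] by linarith
  next
    case (insert i)
    then have "k \<le> card (insert i y)" by (simp only: H_def mem_Collect_eq)
    then show ?thesis using insert(2) finite_in_cube[OF \<open>y \<in> cube n\<close>] by simp
  next
    case self
    then have "k \<le> card y" by (simp only: H_def mem_Collect_eq)
    then show ?thesis by linarith
  qed
  ultimately show "y \<in> {y \<in> cube n. k - 1 \<le> card y}" by simp
next
  fix y assume "y \<in> {y \<in> cube n. k - 1 \<le> card y}"
  then have y: "y \<in> cube n" "k - 1 \<le> card y" by auto
  show "y \<in> nbr n H"
  proof (cases "k \<le> card y")
    case True
    then show ?thesis using y nbr_self[OF H_cube] by (auto simp: H_def)
  next
    case False
    then have "card y < card {1..n}" using kn by simp
    from extend_in_cube[OF y(1) subset_refl this] obtain i where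
      i: "i \<in> {1..n}" "i \<notin> y" "insert i y \<in> cube n" "card (insert i y) = Suc (card y)" .
    then have "insert i y \<in> H" using y k1 by (simp add: H_def)
    from nbr_removeI[OF this H_cube, of i] show ?thesis using i(2) by simp
  qed
qed

text \<open>By \<open>nbr_H\<close> this is the part of \<open>nbr n X\<close> outside
  \<open>nbr n H\<close>. It separates what the sets below \<open>H\<close> contribute from what
  \<open>A \<inter> H\<close> contributes.\<close>

definition low_nbr :: "nat set set \<Rightarrow> nat set set" where
  "low_nbr X = {y \<in> nbr n X. card y < k - 1}"

lemma finite_low_nbr: "finite (low_nbr X)" by (simp add: low_nbr_def)

lemma card_nbr_above_H:
  assumes "H \<subseteq> X"
  shows "card (nbr n X) = card (nbr n H) + card (low_nbr X)"
proof -
  have "nbr n X = nbr n H \<union> low_nbr X"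
    using nbr_mono[OF assms, of n] nbr_cube[of n X] by (auto simp: low_nbr_def nbr_H)
  moreover have "nbr n H \<inter> low_nbr X = {}" by (auto simp: low_nbr_def nbr_H)
  ultimately show ?thesis using card_Un_disjoint finite_low_nbr finite_nbr by metis
qed

text \<open>Harper's theorem bounds the neighbourhood of \<open>A \<inter> H\<close>, which lives in
  sizes at least \<open>k - 1\<close>, and that of \<open>A \<union> H\<close>, whose excess over
  \<open>nbr n H\<close> lives below. The two contributions are disjoint parts of
  \<open>nbr n A\<close>, so the bounds add.\<close>

lemma local_bound:
  assumes A: "A \<subseteq> cube n" "card A = m" "card (A - H) = D"
  shows "card (nbr n (lower_seg D)) + card (low_nbr (upper_seg D)) \<le> card (nbr n A)"
proof -
  have finA: "finite A" using A(1) finite_cube finite_subset by blast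
  have D: "card (A \<inter> H) = m - D"
    using card_Int_Diff[OF finA, of H] A by simp
  have 1: "card (nbr n (lower_seg D)) \<le> card (nbr n (A \<inter> H))"
    using harper[of "A \<inter> H" n] A(1) D by (simp add: lower_seg_def le_infI1)
  have "card (H \<union> (A - H)) = m + D"
    using card_Un_disjoint[OF finite_H, of "A - H"] finA A by (simp add: m_def)
  then have "card (nbr n (upper_seg D)) \<le> card (nbr n (H \<union> (A - H)))"
    using harper[of "H \<union> (A - H)" n] A(1) H_cube unfolding upper_seg_def
    by (metis Diff_subset Un_least order_trans)
  moreover have "card (nbr n (upper_seg D)) = card (nbr n H) + card (low_nbr (upper_seg D))"
    using initial_segment_mono[of m "m + D" n] initial_segment_m
    by (intro card_nbr_above_H) (simp add: upper_seg_def)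
  moreover have "card (nbr n (H \<union> (A - H))) = card (nbr n H) + card (low_nbr (H \<union> (A - H)))"
    by (intro card_nbr_above_H) simp
  ultimately have 2: "card (low_nbr (upper_seg D)) \<le> card (low_nbr (H \<union> (A - H)))" by simp
  have 3: "low_nbr (H \<union> (A - H)) \<subseteq> nbr n (A - H)"
    by (auto simp: low_nbr_def nbr_Un nbr_H simp del: Un_Diff_cancel)
  have "nbr n (A \<inter> H) \<union> low_nbr (H \<union> (A - H)) \<subseteq> nbr n A"
    using 3 nbr_mono[of "A \<inter> H" A n] nbr_mono[of "A - H" A n] by blast
  moreover have "nbr n (A \<inter> H) \<inter> low_nbr (H \<union> (A - H)) = {}"
    using nbr_mono[of "A \<inter> H" H n] unfolding nbr_H low_nbr_def by fastforce
  ultimately have "card (nbr n (A \<inter> H)) + card (low_nbr (H \<union> (A - H))) \<le> card (nbr n A)"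
    by (metis card_Un_disjoint card_mono finite_low_nbr finite_nbr)
  then show ?thesis using 1 2 by simp
qed

text \<open>For \<open>k = 1\<close> and for \<open>k = n\<close> the binomial \<open>M\<close>
  equals 1.\<close>

lemma strict_layer:
  assumes "1 < M"
  shows "k < n" "2 \<le> k"
proof -
  have "1 < (n - 1) choose (k - 1)" using assms by (simp add: M_def)
  then show "k < n" "2 \<le> k" using kn k1 by (cases "k = n"; cases "k = 1"; auto)+
qed

lemma H_sub_nbr_lower_seg:
  assumes "D \<le> M" "k < n"
  shows "H \<subseteq> nbr n (lower_seg D)"
    and "{y \<in> cube n. n \<notin> y \<and> card y = k - 1} \<subseteq> nbr n (lower_seg D)"
proof -
  have sub: "lower_seg D \<subseteq> cube n" using lower_seg(2)[OF assms(1)] H_cube by blast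
  note low = lower_seg(1)[OF assms(1)]
  show "H \<subseteq> nbr n (lower_seg D)"
  proof
    fix y assume y: "y \<in> H"
    then have yc: "y \<in> cube n" "k \<le> card y" by (auto simp: H_def)
    show "y \<in> nbr n (lower_seg D)"
    proof (cases "k < card y")
      case True
      then have "y \<in> lower_seg D" using low yc by (auto simp: colex_layer_def)
      then show ?thesis using nbr_self[OF sub] by blast
    next
      case False
      then have "card y < card {1..n}" using assms(2) by simp
      from extend_in_cube[OF yc(1) subset_refl this] obtain i where
        i: "i \<notin> y" "insert i y \<in> cube n" "card (insert i y) = Suc (card y)" .
      then have "insert i y \<in> lower_seg D" using low yc by (auto simp: colex_layer_def)
      from nbr_removeI[OF this sub, of i] show ?thesis using i(1) by simp
    qed
  qed
  show "{y \<in> cube n. n \<notin> y \<and> card y = k - 1} \<subseteq> nbr n (lower_seg D)"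
  proof
    fix y assume "y \<in> {y \<in> cube n. n \<notin> y \<and> card y = k - 1}"
    then have y: "y \<in> cube n" "n \<notin> y" "card y = k - 1" by auto
    \<comment> \<open>The added element must differ from \<open>n\<close> to stay in the colex
      layer; \<open>k < n\<close> leaves room for it.\<close>
    then have "card y < card {1..n - 1}" using assms(2) k1 by simp
    moreover have "{1..n - 1} \<subseteq> {1..n}" by auto
    ultimately obtain i where
      i: "i \<in> {1..n - 1}" "i \<notin> y" "insert i y \<in> cube n" "card (insert i y) = Suc (card y)"
      using extend_in_cube[OF y(1)] by metis
    then have "insert i y \<in> colex_layer n k" using y k1 n1 by (auto simp: colex_layer_def)
    from nbr_removeI[OF subsetD[OF low this] sub, of i] show "y \<in> nbr n (lower_seg D)"
      using i(2) by simp
  qed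
qed

text \<open>The bound of \<open>local_bound\<close> is attained: sets of
  \<open>upper_seg D - H\<close> have size \<open>k - 1\<close> and avoid \<open>n\<close>, so they
  and their upper neighbours already belong to the neighbourhood of
  \<open>lower_seg D\<close>.\<close>

lemma card_nbr_extremal:
  assumes "D < M"
  shows "card (nbr n (lower_seg D \<union> (upper_seg D - H)))
    \<le> card (nbr n (lower_seg D)) + card (low_nbr (upper_seg D))"
proof (cases "D = 0")
  \<comment> \<open>\<open>D = 0\<close> is treated apart because \<open>M\<close> may then be 1,
    and \<open>k < n\<close> may fail.\<close>
  case True
  then have "upper_seg D - H = {}" by (simp add: upper_seg_def initial_segment_m)
  then show ?thesis by (simp only: Un_empty_right le_add1)
next
  case False
  then have kn': "k < n" "2 \<le> k" using strict_layer assms by simp_all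
  have D: "D \<le> M" using assms by simp
  note sub = H_sub_nbr_lower_seg[OF D kn'(1)]
  have "nbr n (upper_seg D - H) \<subseteq> nbr n (lower_seg D) \<union> low_nbr (upper_seg D)"
  proof
    fix y assume y: "y \<in> nbr n (upper_seg D - H)"
    then have yc: "y \<in> cube n" using nbr_cube by blast
    show "y \<in> nbr n (lower_seg D) \<union> low_nbr (upper_seg D)" using y
    proof (cases rule: nbrE)
      case self
      then show ?thesis using upper_seg_minus_H[OF D self] sub(2) by blast
    next
      case (remove i)
      have "card y = Suc (card (y - {i}))"
        using remove(2) finite_in_cube[OF yc] by (metis card.remove)
      then have "y \<in> H" using upper_seg_minus_H[OF D remove(3)] yc k1 by (simp add: H_def)
      then show ?thesis using sub(1) by blast
    next
      case (insert i)
      have "card (insert i y) = Suc (card y)" using insert(2) finite_in_cube[OF yc] by simp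
      then have "card y < k - 1" using upper_seg_minus_H[OF D insert(3)] by simp
      moreover have "y \<in> nbr n (upper_seg D)" using y nbr_mono[of "upper_seg D - H" "upper_seg D"] by blast
      ultimately show ?thesis by (simp add: low_nbr_def)
    qed
  qed
  then have "nbr n (lower_seg D \<union> (upper_seg D - H)) \<subseteq> nbr n (lower_seg D) \<union> low_nbr (upper_seg D)"
    by (simp add: nbr_Un)
  then have "card (nbr n (lower_seg D \<union> (upper_seg D - H))) \<le> card (nbr n (lower_seg D) \<union> low_nbr (upper_seg D))"
    by (rule card_mono[rotated]) (simp add: finite_low_nbr)
  also have "\<dots> \<le> card (nbr n (lower_seg D)) + card (low_nbr (upper_seg D))" by (rule card_Un_le)
  finally show ?thesis .
qed

lemma boundary_extremal_le:
  assumes A: "A \<subseteq> cube n" "card A = m" "card (A - H) = D" and D: "D < M"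
  shows "card (vertex_boundary n (initial_segment n (m - D) \<union> (initial_segment n (m + D) - initial_segment n m)))
    \<le> card (vertex_boundary n A)"
proof -
  let ?J = "lower_seg D \<union> (upper_seg D - H)"
  have D': "D \<le> M" using D by simp
  have Jc: "?J \<subseteq> cube n"
    using initial_segment_cube unfolding lower_seg_def upper_seg_def by blast
  have fin: "finite (lower_seg D)" using lower_seg(2)[OF D'] finite_H finite_subset by blast
  have "lower_seg D \<inter> (upper_seg D - H) = {}" using lower_seg(2)[OF D'] by blast
  then have "card ?J = m - D + D"
    using card_Un_disjoint[OF fin, of "upper_seg D - H"] finite_upper_seg
    by (simp add: lower_seg(3)[OF D'] card_upper_seg_minus_H[OF D'])
  moreover have "D \<le> m" using D' card_colex_layer_low by simp
  ultimately have cJ: "card ?J = m" by simp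
  have "card (nbr n ?J) \<le> card (nbr n A)"
    using card_nbr_extremal[OF D] local_bound[OF A] by simp
  then have "card (vertex_boundary n ?J) \<le> card (vertex_boundary n A)"
    using card_nbr[OF Jc] card_nbr[OF A(1)] cJ A(2) by simp
  then show ?thesis by (simp add: initial_segment_m lower_seg_def upper_seg_def)
qed

section \<open>The gap between small and large distances from a ball\<close>

lemma card_nbr_lower_seg:
  assumes D: "D \<le> M" "k < n"
  shows "\<exists>P :: nat set set. finite P \<and> card P = M - D \<and> (\<forall>x\<in>P. finite x \<and> card x = k - 1) \<and>
    m + M + card (shadow P) \<le> card (nbr n (lower_seg D))"
proof -
  \<comment> \<open>The link of \<open>n\<close>: the sets of the segment beyond
    \<open>colex_layer n k\<close>, with their common element \<open>n\<close> removed.\<close>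
  define P where "P = {x. n \<notin> x \<and> insert n x \<in> lower_seg D \<and> card x = k - 1}"
  note ls = lower_seg[OF D(1)]
  have sub: "lower_seg D \<subseteq> cube n" using ls(2) H_cube by blast
  have fin: "finite (lower_seg D)" using ls(2) finite_H finite_subset by blast
  have finx: "finite x" if "x \<in> P" for x
    using that sub finite_in_cube[of "insert n x" n] by (auto simp: P_def)
  have inj: "inj_on (insert n) X" if "\<And>A. A \<in> X \<Longrightarrow> n \<notin> A" for X
  proof (rule inj_onI)
    fix A B assume "A \<in> X" "B \<in> X" "insert n A = insert n B"
    then show "A = B" using that[of A] that[of B] insert_ident[of n A B] by simp
  qed
  have img: "insert n ` P = lower_seg D - colex_layer n k"
  proof (intro equalityI subsetI)
    fix x assume "x \<in> insert n ` P"
    then obtain y where y: "y \<in> P" "x = insert n y" by blast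
    then have "card x = k" using finx[OF y(1)] k1 by (simp add: P_def)
    then show "x \<in> lower_seg D - colex_layer n k" using y by (simp add: P_def colex_layer_def)
  next
    fix x assume x: "x \<in> lower_seg D - colex_layer n k"
    then have xc: "x \<in> cube n" "k \<le> card x" using ls(2) by (auto simp: H_def)
    then have "n \<in> x" "card x = k" using x by (auto simp: colex_layer_def)
    then have "x - {n} \<in> P" "x = insert n (x - {n})"
      using x by (auto simp: P_def insert_absorb)
    then show "x \<in> insert n ` P" by blast
  qed
  have nP: "n \<notin> A" if "A \<in> P" for A using that by (simp add: P_def)
  have "finite (insert n ` P)" unfolding img using fin by simp
  then have finP: "finite P" by (rule finite_imageD[OF _ inj[OF nP]])
  have "card P = card (lower_seg D - colex_layer n k)"
    using card_image[OF inj[OF nP], of P] img by simp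
  also have "\<dots> = (m - D) - card (colex_layer n k)"
    using ls fin finite_subset by (subst card_Diff_subset) auto
  also have "\<dots> = M - D" using card_colex_layer_low by simp
  finally have cP: "card P = M - D" .
  have nS: "n \<notin> A" if "A \<in> shadow P" for A using that by (auto simp: shadow_def P_def)
  have finS: "finite (shadow P)" using finP finx by (rule finite_shadow)
  let ?L = "{y \<in> cube n. n \<notin> y \<and> card y = k - 1}"
  have "insert n ` shadow P \<subseteq> nbr n (lower_seg D)"
  proof
    fix y assume "y \<in> insert n ` shadow P"
    then obtain x a where x: "x \<in> P" "a \<in> x" "y = insert n (x - {a})" by (auto simp: shadow_def)
    then have "a \<noteq> n" using nP by blast
    then have y: "y = insert n x - {a}" using x by blast
    have "insert n x \<in> lower_seg D" using x(1) by (simp add: P_def)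
    then show "y \<in> nbr n (lower_seg D)" unfolding y by (rule nbr_removeI[OF _ sub])
  qed
  \<comment> \<open>Three disjoint parts: sizes at least \<open>k\<close>, smaller sets avoiding
    \<open>n\<close>, and smaller sets containing \<open>n\<close>.\<close>
  then have "H \<union> ?L \<union> insert n ` shadow P \<subseteq> nbr n (lower_seg D)"
    using H_sub_nbr_lower_seg[OF D] by blast
  then have "card (H \<union> ?L \<union> insert n ` shadow P) \<le> card (nbr n (lower_seg D))"
    by (rule card_mono[OF finite_nbr])
  moreover have "H \<inter> ?L = {}" using k1 by (auto simp: H_def)
  moreover have "(H \<union> ?L) \<inter> insert n ` shadow P = {}"
  proof -
    have "card (insert n A) < k" if A: "A \<in> shadow P" for A
    proof -
      obtain x a where x: "x \<in> P" "a \<in> x" "A = x - {a}" using A by (auto simp: shadow_def)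
      have "card A < card x" using x finx[OF x(1)] by (metis card_Diff1_less)
      then have "card A < k - 1" using x(1) by (simp add: P_def)
      then show ?thesis using card_insert_le_m1[of k A n] nS[OF A] finx[OF x(1)] x(3) by simp
    qed
    then have "card y < k \<and> n \<in> y" if "y \<in> insert n ` shadow P" for y using that by blast
    then show ?thesis unfolding H_def by (fastforce simp: not_le[symmetric])
  qed
  moreover have "card (insert n ` shadow P) = card (shadow P)"
    by (rule card_image[OF inj[OF nS]])
  moreover have "card ?L = M" by (simp add: card_level_avoid[OF n1] M_def)
  moreover have "finite ?L" by (simp add: finite_cube)
  ultimately have bound: "m + M + card (shadow P) \<le> card (nbr n (lower_seg D))"
    using finite_H finS by (simp add: card_Un_disjoint m_def)
  have "finite x \<and> card x = k - 1" if "x \<in> P" for x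
    using that finx[OF that] by (simp add: P_def)
  then show ?thesis using finP cP bound by metis
qed

text \<open>The boundary is at least \<open>M\<close> plus the shadows of two families of
  \<open>(k - 1)\<close>-sets of sizes \<open>M - D\<close> and \<open>D\<close>.
  \<open>shadow_ratio\<close> gives \<open>(k - 1) * M\<close> for the pair, and the smaller family
  brings the extra half. Without that term the bound is the boundary of the ball, since
  \<open>(n - k + 1) * (n choose (k - 1)) = n * M\<close>.\<close>

lemma gap:
  assumes A: "A \<subseteq> cube n" "card A = m" "card (A - H) = D" and D: "0 < D" "D < M"
  shows "real n * real M + min (real D) (real M - real D) / 2
    \<le> (real n - real k + 1) * real (card (vertex_boundary n A))"
proof -
  have kn': "k < n" "2 \<le> k" using strict_layer D by simp_all
  have D': "D \<le> M" using D by simp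
  obtain P :: "nat set set" where P: "finite P" "card P = M - D" "\<And>x. x \<in> P \<Longrightarrow> finite x \<and> card x = k - 1"
    "m + M + card (shadow P) \<le> card (nbr n (lower_seg D))"
    using card_nbr_lower_seg[OF D' kn'(1)] by metis
  define Q where "Q = upper_seg D - H"
  have Q: "finite Q" "card Q = D" "\<And>x. x \<in> Q \<Longrightarrow> finite x \<and> card x = k - 1"
    using finite_upper_seg card_upper_seg_minus_H[OF D'] upper_seg_minus_H[OF D'] finite_in_cube[of _ n]
    unfolding Q_def by blast+
  have usc: "upper_seg D \<subseteq> cube n" using initial_segment_cube by (simp add: upper_seg_def)
  have "shadow Q \<subseteq> low_nbr (upper_seg D)"
  proof
    fix y assume "y \<in> shadow Q"
    then obtain x a where x: "x \<in> Q" "a \<in> x" "y = x - {a}" by (auto simp: shadow_def)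
    have "card y < card x" using x Q(3)[OF x(1)] by (metis card_Diff1_less)
    moreover have "y \<in> nbr n (upper_seg D)"
      unfolding x(3) using x(1) by (intro nbr_removeI[OF _ usc]) (simp add: Q_def)
    ultimately show "y \<in> low_nbr (upper_seg D)" using Q(3)[OF x(1)] by (simp add: low_nbr_def)
  qed
  then have "card (shadow Q) \<le> card (low_nbr (upper_seg D))"
    by (rule card_mono[OF finite_low_nbr])
  then have "m + M + card (shadow P) + card (shadow Q) \<le> card (nbr n A)"
    using P(4) local_bound[OF A] by simp
  then have b: "M + card (shadow P) + card (shadow Q) \<le> card (vertex_boundary n A)"
    using card_nbr[OF A(1)] A(2) by simp
  \<comment> \<open>Ratios are taken with ground size \<open>n - 1\<close> and set size
    \<open>Suc r = k - 1\<close>, which turns \<open>N - r\<close> into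
    \<open>n - k + 1\<close>.\<close>
  define r where "r = k - 2"
  have r: "k - 1 = Suc r" "Suc r \<le> n - 1" "real (n - 1) - real r = real n - real k + 1"
    "real (Suc r) = real k - 1"
    using kn' by (auto simp: r_def of_nat_diff)
  have M: "M = (n - 1) choose Suc r" unfolding M_def r(1) ..
  have P0: "P \<noteq> {}" and Q0: "Q \<noteq> {}" using P(2) Q(2) D by auto
  have PM: "card P \<le> (n - 1) choose Suc r" "card Q \<le> (n - 1) choose Suc r"
    using P(2) Q(2) D' M by auto
  let ?c = "real n - real k + 1"
  let ?p = "real (card (shadow P))" and ?q = "real (card (shadow Q))"
  note sP = shadow_ratio[OF P(1) P(3)[unfolded r(1)] P0 r(2) PM(1), unfolded r(3,4)]
  note sQ = shadow_ratio[OF Q(1) Q(3)[unfolded r(1)] Q0 r(2) PM(2), unfolded r(3,4)]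
  have cards: "real (card P) = real M - real D" "real (card Q) = real D"
    using P(2) Q(2) D' by auto
  define \<mu> where "\<mu> = min (real D) (real M - real D)"
  have \<mu>: "\<mu> \<le> real D" "\<mu> \<le> real M - real D" by (simp_all add: \<mu>_def)
  have "(real k - 1) * real M + \<mu> / 2 \<le> ?c * ?p + ?c * ?q"
  proof (cases "2 * D \<le> M")
    case True
    have "(real k - 1 + 1 / 2) * real D \<le> ?c * ?q" using sQ(2) True Q(2) M cards by simp
    moreover have "(real k - 1) * (real M - real D) \<le> ?c * ?p" using sP(1) cards by simp
    ultimately show ?thesis using \<mu>(1) by (simp add: algebra_simps)
  next
    case False
    have "(real k - 1 + 1 / 2) * (real M - real D) \<le> ?c * ?p" using sP(2) False P(2) M cards by simp
    moreover have "(real k - 1) * real D \<le> ?c * ?q" using sQ(1) cards by simp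
    ultimately show ?thesis using \<mu>(2) by (simp add: algebra_simps)
  qed
  then have "real n * real M + \<mu> / 2 \<le> ?c * (real M + ?p + ?q)"
    by (simp add: algebra_simps)
  also have "\<dots> \<le> ?c * real (card (vertex_boundary n A))"
  proof (rule mult_left_mono)
    show "real M + ?p + ?q \<le> real (card (vertex_boundary n A))" using b by linarith
  qed (use kn in simp)
  finally show ?thesis unfolding \<mu>_def .
qed

end

section \<open>Undoing the compressions\<close>

lemma card_top_layers: "card {x \<in> cube n. k \<le> card x} = (\<Sum>i=k..n. n choose i)"
proof -
  have le: "card x \<le> n" if "x \<in> cube n" for x
    using that card_mono[of "{1..n}" x] by (simp add: cube_def)
  have "{x \<in> cube n. k \<le> card x} = (\<Union>i\<in>{k..n}. {x \<in> cube n. card x = i})"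
    using le by auto
  also have "card \<dots> = (\<Sum>i\<in>{k..n}. card {x \<in> cube n. card x = i})"
    by (rule card_UN_disjoint) (auto simp: finite_cube)
  finally show ?thesis by (simp only: card_level)
qed

section \<open>Translations of the cube\<close>

abbreviation translate :: "'a set \<Rightarrow> 'a set set \<Rightarrow> 'a set set" where
  "translate t A \<equiv> (\<lambda>x. sym_diff x t) ` A"

lemma sym_diff_cancel: "sym_diff (sym_diff x t) t = x" by blast

lemma inj_on_translate: "inj_on (\<lambda>x. sym_diff x t) A"
  by (rule inj_onI) (metis sym_diff_cancel)

lemma card_translate: "card (translate t A) = card A"
  by (rule card_image[OF inj_on_translate])

lemma translate_cube:
  assumes "A \<subseteq> cube n" "t \<in> cube n"
  shows "translate t A \<subseteq> cube n"
  using assms unfolding cube_def by blast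

lemma mem_translate_iff: "y \<in> translate t A \<longleftrightarrow> sym_diff y t \<in> A"
  by (metis (no_types, lifting) image_iff sym_diff_cancel)

lemma nbr_translate:
  assumes t: "t \<in> cube n"
  shows "nbr n (translate t A) = translate t (nbr n A)"
proof (rule set_eqI)
  fix y
  have "sym_diff (sym_diff y {i}) t = sym_diff (sym_diff y t) {i}" for i by blast
  moreover have "y \<in> cube n \<longleftrightarrow> sym_diff y t \<in> cube n"
    using t unfolding cube_def by blast
  ultimately show "y \<in> nbr n (translate t A) \<longleftrightarrow> y \<in> translate t (nbr n A)"
    unfolding nbr_def mem_translate_iff mem_Collect_eq by simp
qed

lemma card_vertex_boundary_translate:
  assumes "A \<subseteq> cube n" "t \<in> cube n"
  shows "card (vertex_boundary n (translate t A)) = card (vertex_boundary n A)"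
  using card_nbr[OF assms(1)] card_nbr[OF translate_cube[OF assms]] nbr_translate[OF assms(2), of A]
  by (simp add: card_translate)

text \<open>The delicate case is \<open>e \<in> V\<close>. Then the smaller pair without
  \<open>e\<close> and some \<open>u\<close> is stable, and the up-set property puts
  \<open>u\<close> back; this is \<open>key\<close>.\<close>

lemma insert_compr_up_pair:
  assumes UV: "up_pair n U V" and V0: "V \<noteq> {}" and F: "F \<subseteq> cube n" and up: "upset n F"
    and st: "\<And>u v. u \<in> U \<Longrightarrow> v \<in> V \<Longrightarrow> compr_stable (U - {u}) (V - {v}) F"
    and z: "z \<in> compr U V F" and e: "e \<in> {1..n}" "e \<notin> z"
  shows "insert e z \<in> compr U V F"
proof -
  have d: "U \<inter> V = {}" and sub: "U \<subseteq> {1..n}" "V \<subseteq> {1..n}" and "card U = Suc (card V)"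
    using UV by (auto simp: up_pair_def)
  then obtain u where u: "u \<in> U" by fastforce
  have key: "(w - (V - {e})) \<union> U \<in> F"
    if w: "w \<in> F" "V - {e} \<subseteq> w" "U \<inter> w = {}" and eV: "e \<in> V" for w
  proof -
    have "(U - {u}) \<inter> w = {}" using w(3) by blast
    from compr_stableD[OF st[OF u eV] w(1,2) this] have "(w - (V - {e})) \<union> (U - {u}) \<in> F" .
    moreover have "(w - (V - {e})) \<union> (U - {u}) \<subseteq> (w - (V - {e})) \<union> U" by blast
    moreover have "(w - (V - {e})) \<union> U \<subseteq> {1..n}" using w(1) F sub unfolding cube_def by blast
    ultimately show ?thesis using upsetD[OF up] by blast
  qed
  show ?thesis
  proof (cases "z \<in> F")
    case True
    then have y: "insert e z \<in> F" using up e by (auto simp: upset_def)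
    have "swap U V (insert e z) \<in> F" if a: "V \<subseteq> insert e z" "U \<inter> insert e z = {}"
    proof (cases "e \<in> V")
      case eV: True
      have "swap U V (insert e z) = (z - (V - {e})) \<union> U" using eV e unfolding swap_def by blast
      also have "\<dots> \<in> F" using a by (intro key[OF True _ _ eV]) blast+
      finally show ?thesis .
    next
      case eV: False
      then have "V \<subseteq> z \<and> U \<inter> z = {}" using a by blast
      then have "swap U V z \<in> F" using z by (simp add: compr_def)
      then have "insert e (swap U V z) \<in> F" using up e by (auto simp: upset_def)
      moreover have "insert e (swap U V z) = swap U V (insert e z)" using eV unfolding swap_def by blast
      ultimately show ?thesis by simp
    qed
    then show ?thesis using y by (intro comprI)
  next
    case False
    then obtain x where x: "x \<in> F" "z = swap U V x" "V \<subseteq> x" "U \<inter> x = {}"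
      using compr_sub[OF d z] by (elim disjE bexE conjE) blast+
    have na: "\<not> (V \<subseteq> insert e z \<and> U \<inter> insert e z = {})" using u x(2) unfolding swap_def by blast
    show ?thesis
    proof (cases "e \<in> V")
      case True
      have "insert e z = (x - (V - {e})) \<union> U" using True x d unfolding swap_def by blast
      also have "\<dots> \<in> F" using x by (intro key[OF x(1) _ _ True]) blast+
      finally show ?thesis using na by (intro comprI) blast+
    next
      case eV: False
      have "U \<subseteq> insert e z" "V \<inter> insert e z = {}" using x(2) eV d unfolding swap_def by blast+
      moreover have "e \<notin> U" using e x(2) unfolding swap_def by blast
      then have "swap V U (insert e z) = insert e x" using x d unfolding swap_def by blast
      moreover have "insert e x \<in> F" using up e x(1) by (auto simp: upset_def)
      ultimately show ?thesis unfolding compr_def mem_Collect_eq if_not_P[OF na] by simp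
    qed
  qed
qed

lemma upset_compr_up_pair:
  assumes "up_pair n U V" "V \<noteq> {}" "F \<subseteq> cube n" "upset n F"
    and "\<And>u v. u \<in> U \<Longrightarrow> v \<in> V \<Longrightarrow> compr_stable (U - {u}) (V - {v}) F"
  shows "upset n (compr U V F)"
  unfolding upset_def
proof (intro ballI)
  fix z e assume "z \<in> compr U V F" "e \<in> {1..n}"
  then show "insert e z \<in> compr U V F"
    using insert_compr_up_pair[OF assms] by (cases "e \<in> z") (simp_all add: insert_absorb)
qed

lemma compr_stable_compr_up: "compr_stable {i} {} (compr {i} {} F)"
  unfolding compr_stable_def
proof (intro ballI impI)
  fix x assume x: "x \<in> compr {i} {} F" "{} \<subseteq> x" "{i} \<inter> x = {}"
  then have "swap {i} {} x \<in> F" by (simp add: compr_def)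
  then show "swap {i} {} x \<in> compr {i} {} F" by (simp add: compr_def swap_def)
qed

text \<open>Split the \<open>p\<close> points into \<open>2 * a\<close> and the rest: the
  Vandermonde term with \<open>a\<close> points from the first part alone contributes a factor
  \<open>(2 * a) choose a \<ge> 2\<close>.\<close>

lemma twice_binomial_le:
  assumes "0 < a" "2 * a \<le> p" "a \<le> q"
  shows "2 * ((p - 2 * a) choose (q - a)) \<le> p choose q"
proof -
  have "2 \<le> (2 * a) choose a"
  proof -
    obtain b where b: "a = Suc b" using assms(1) by (cases a) auto
    have "(2 * a) choose a = ((2 * b + 1) choose b) + ((2 * b + 1) choose Suc b)" by (simp add: b)
    moreover have "0 < (2 * b + 1) choose b" "0 < (2 * b + 1) choose Suc b" by (simp_all del: binomial_Suc_Suc)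
    ultimately show ?thesis by linarith
  qed
  then have "2 * ((p - 2 * a) choose (q - a)) \<le> ((2 * a) choose a) * ((p - 2 * a) choose (q - a))"
    by simp
  also have "\<dots> \<le> (\<Sum>j\<le>q. ((2 * a) choose j) * ((p - 2 * a) choose (q - j)))"
    by (rule member_le_sum[of a "{..q}" "\<lambda>j. ((2 * a) choose j) * ((p - 2 * a) choose (q - j))"])
      (use assms in auto)
  also have "\<dots> = (2 * a + (p - 2 * a)) choose q" by (rule vandermonde)
  finally show ?thesis using assms(2) by simp
qed

context layers
begin

section \<open>Balls of size \<open>m\<close> with arbitrary centre\<close>

abbreviation ball :: "nat set \<Rightarrow> nat set set" where "ball C \<equiv> ball_at n (n - k) C"

text \<open>\<open>H\<close> is the ball of radius \<open>n - k\<close> about the full set, and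
  translating by the complement of \<open>C\<close> moves that centre to \<open>C\<close>.
  Boundaries are invariant, so all bounds proved for \<open>H\<close> transfer.\<close>

lemma ball_eq_translate:
  assumes "C \<in> cube n"
  shows "ball C = translate ({1..n} - C) H"
proof (rule set_eqI)
  fix x
  show "x \<in> ball C \<longleftrightarrow> x \<in> translate ({1..n} - C) H"
  proof (cases "x \<in> cube n")
    case True
    have "sym_diff x ({1..n} - C) = {1..n} - sym_diff x C"
      using True assms unfolding cube_def by blast
    moreover have "sym_diff x C \<subseteq> {1..n}" using True assms unfolding cube_def by blast
    then have "card ({1..n} - sym_diff x C) = n - card (sym_diff x C)" "card (sym_diff x C) \<le> n"
      using card_mono[of "{1..n}" "sym_diff x C"] finite_subset[of "sym_diff x C" "{1..n}"]
      by (simp_all add: card_Diff_subset)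
    ultimately show ?thesis
      using True kn unfolding mem_translate_iff by (auto simp: ball_at_def H_def cube_def)
  next
    case False
    then have "sym_diff x ({1..n} - C) \<notin> cube n" using assms unfolding cube_def by blast
    then show ?thesis using False unfolding mem_translate_iff by (simp add: ball_at_def H_def)
  qed
qed

lemma ball_full: "ball {1..n} = H"
  using ball_eq_translate[of "{1..n}"] by (simp add: cube_def)

lemma ball_cube: "ball C \<subseteq> cube n" by (auto simp: ball_at_def)

lemma finite_in: "A \<subseteq> cube n \<Longrightarrow> finite A"
  using finite_cube finite_subset by metis

lemma card_ball: "C \<in> cube n \<Longrightarrow> card (ball C) = m"
  by (simp add: ball_eq_translate card_translate m_def)

lemma card_ball_diff:
  assumes "C \<in> cube n" "A \<subseteq> cube n" "card A = m"
  shows "card (ball C - A) = card (A - ball C)"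
proof -
  have "card (A \<inter> ball C) + card (A - ball C) = m"
    using card_Int_Diff[OF finite_in[OF assms(2)], of "ball C"] assms(3) by simp
  moreover have "card (ball C \<inter> A) + card (ball C - A) = m"
    using card_Int_Diff[OF finite_in[OF ball_cube], of C A] card_ball[OF assms(1)] by simp
  ultimately show ?thesis by (simp add: Int_commute)
qed

lemma card_diff_ball_translate:
  assumes "C \<in> cube n"
  shows "card (A - ball C) = card (translate ({1..n} - C) A - H)"
proof -
  let ?t = "{1..n} - C"
  have eq: "translate ?t (A - ball C) = translate ?t A - H"
    by (rule set_eqI) (simp only: ball_eq_translate[OF assms] mem_translate_iff Diff_iff sym_diff_cancel)
  show ?thesis unfolding eq[symmetric] by (rule card_translate[symmetric])
qed

lemma complement_cube: "{1..n} - C \<in> cube n" by (auto simp: cube_def)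

lemma gap_ball:
  assumes A: "A \<subseteq> cube n" "card A = m" and C: "C \<in> cube n" and D: "card (A - ball C) = D" "0 < D" "D < M"
  shows "real n * real M + min (real D) (real M - real D) / 2
    \<le> (real n - real k + 1) * real (card (vertex_boundary n A))"
  using gap[OF translate_cube[OF A(1) complement_cube] _ _ D(2,3)] A D(1)
    card_diff_ball_translate[OF C] card_vertex_boundary_translate[OF A(1) complement_cube]
  by (simp add: card_translate)

lemma boundary_extremal_le_ball:
  assumes A: "A \<subseteq> cube n" "card A = m" and C: "C \<in> cube n" and D: "card (A - ball C) = D" "D < M"
  shows "card (vertex_boundary n (initial_segment n (m - D) \<union> (initial_segment n (m + D) - initial_segment n m)))
    \<le> card (vertex_boundary n A)"
  using boundary_extremal_le[OF translate_cube[OF A(1) complement_cube] _ _ D(2)] A D(1)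
    card_diff_ball_translate[OF C] card_vertex_boundary_translate[OF A(1) complement_cube]
  by (simp add: card_translate)

text \<open>The distance to \<open>C\<close> splits into the distance in the other coordinates and
  the contribution 0 or 1 of coordinate \<open>i\<close>.\<close>

lemma mem_ball_section:
  assumes "C \<in> cube n" "x \<in> cube n" "i \<notin> x" "i \<in> {1..n}"
  shows "x \<in> ball C \<longleftrightarrow> card (sym_diff x (C - {i})) + (if i \<in> C then 1 else 0) \<le> n - k"
    and "insert i x \<in> ball C \<longleftrightarrow> card (sym_diff x (C - {i})) + (if i \<in> C then 0 else 1) \<le> n - k"
proof -
  define e where "e = sym_diff x (C - {i})"
  have fin: "finite e" "i \<notin> e"
    using assms finite_in_cube[of _ n] by (auto simp: e_def)
  have 1: "sym_diff x C = (if i \<in> C then insert i e else e)"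
    "sym_diff (insert i x) C = (if i \<in> C then e else insert i e)"
    using assms(3) by (auto simp: e_def)
  have "insert i x \<in> cube n" using assms by (simp add: cube_def)
  then show "x \<in> ball C \<longleftrightarrow> card (sym_diff x (C - {i})) + (if i \<in> C then 1 else 0) \<le> n - k"
    "insert i x \<in> ball C \<longleftrightarrow> card (sym_diff x (C - {i})) + (if i \<in> C then 0 else 1) \<le> n - k"
    using fin assms(2) unfolding ball_at_def mem_Collect_eq 1 e_def[symmetric] by simp_all
qed

text \<open>One endpoint of each edge in direction \<open>i\<close> with exactly one end in \<open>ball C\<close>.\<close>

definition sphere :: "nat \<Rightarrow> nat set \<Rightarrow> nat set set" where
  "sphere i C = {x \<in> cube n. i \<notin> x \<and> card (sym_diff x (C - {i})) = n - k}"

lemma card_sphere: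
  assumes C: "C \<in> cube n" and i: "i \<in> {1..n}"
  shows "card (sphere i C) = M"
proof -
  let ?t = "C - {i}"
  let ?S = "{y. y \<subseteq> {1..n} - {i} \<and> card y = n - k}"
  have "sphere i C = translate ?t ?S"
  proof (rule set_eqI)
    fix x
    have "x \<in> cube n \<and> i \<notin> x \<longleftrightarrow> sym_diff x ?t \<subseteq> {1..n} - {i}"
      using C unfolding cube_def by blast
    then show "x \<in> sphere i C \<longleftrightarrow> x \<in> translate ?t ?S"
      unfolding sphere_def mem_translate_iff mem_Collect_eq by blast
  qed
  then have "card (sphere i C) = card ?S" by (simp only: card_translate)
  also have "\<dots> = card ({1..n} - {i}) choose (n - k)" by (rule n_subsets) simp
  also have "\<dots> = (n - 1) choose (n - k)" using i by simp
  also have "\<dots> = M"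
    using binomial_symmetric[of "k - 1" "n - 1"] k1 kn by (simp add: M_def)
  finally show ?thesis .
qed

end

text \<open>The condition \<open>4 * \<tau> < M\<close> says that
  \<open>\<tau> + M / 2 < M - \<tau>\<close>: a growth by at most \<open>M / 2\<close> from at most
  \<open>\<tau>\<close> cannot cross the forbidden range.\<close>

locale stability = layers +
  fixes \<tau> :: real
  assumes tau: "0 \<le> \<tau>" "4 * \<tau> < real M"
begin

text \<open>The boundary size is written as \<open>card (nbr n A) - m\<close>, which compressions
  can only lower. The slack \<open>\<tau> / 2\<close> matches the term
  \<open>min D (M - D) / 2\<close> of \<open>gap\<close>, so \<open>\<tau> < D < M - \<tau>\<close>
  becomes impossible.\<close>

definition tight :: "nat set set \<Rightarrow> bool" where
  "tight A \<longleftrightarrow> A \<subseteq> cube n \<and> card A = m \<and>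
     (real n - real k + 1) * (real (card (nbr n A)) - real m) \<le> real n * real M + \<tau> / 2"

lemma tight_gap:
  assumes A: "tight A" and C: "C \<in> cube n" and D: "real (card (A - ball C)) < real M - \<tau>"
  shows "real (card (A - ball C)) \<le> \<tau>"
proof (rule ccontr)
  let ?D = "card (A - ball C)"
  assume D\<tau>: "\<not> real ?D \<le> \<tau>"
  then have "0 < ?D" "?D < M" using tau(1) D by linarith+
  moreover have Ac: "A \<subseteq> cube n" "card A = m" using A by (auto simp: tight_def)
  ultimately have "real n * real M + min (real ?D) (real M - real ?D) / 2
    \<le> (real n - real k + 1) * real (card (vertex_boundary n A))"
    by (intro gap_ball[OF _ _ C refl])
  also have "real (card (vertex_boundary n A)) = real (card (nbr n A)) - real m"
    using card_nbr[OF Ac(1)] Ac(2) by simp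
  also have "(real n - real k + 1) * \<dots> \<le> real n * real M + \<tau> / 2" using A by (simp add: tight_def)
  finally show False using D D\<tau> by (simp add: min_def split: if_splits)
qed

lemma tight_compr:
  assumes A: "tight A" and UV: "up_pair n U V"
    and st: "\<And>u v. u \<in> U \<Longrightarrow> v \<in> V \<Longrightarrow> compr_stable (U - {u}) (V - {v}) A"
  shows "tight (compr U V A)"
proof -
  have Ac: "A \<subseteq> cube n" "card A = m" using A by (auto simp: tight_def)
  have d: "U \<inter> V = {}" "U \<subseteq> {1..n}" using UV by (auto simp: up_pair_def)
  have "real (card (nbr n (compr U V A))) - real m \<le> real (card (nbr n A)) - real m"
    using card_nbr_compr_up_pair[OF UV Ac(1) st] by simp
  then have "(real n - real k + 1) * (real (card (nbr n (compr U V A))) - real m)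
    \<le> (real n - real k + 1) * (real (card (nbr n A)) - real m)"
    using kn by (intro mult_left_mono) auto
  then show ?thesis
    using A compr_cube[OF d Ac(1)] card_compr[OF d(1), of A] unfolding tight_def by simp
qed

section \<open>Descent by total deficit and tracking members through a compression\<close>

lemma deficit_compr_less:
  assumes "A \<subseteq> cube n" "up_pair n U V" "\<not> compr_stable U V A"
  shows "(\<Sum>x\<in>compr U V A. n - card x) < (\<Sum>x\<in>A. n - card x)"
proof (rule sum_compr_less[OF _ finite_in[OF assms(1)] assms(3)])
  show "U \<inter> V = {}" using assms(2) by (simp add: up_pair_def)
  show "n - card (swap U V x) < n - card x" if "x \<in> A" "V \<subseteq> x" "U \<inter> x = {}" for x
  proof -
    have "x \<in> cube n" using that(1) assms(1) by blast
    note s = card_swap_up_pair[OF assms(2) that(2,3) this]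
    have "card (swap U V x) \<le> n"
      using s(2) card_mono[of "{1..n}" "swap U V x"] by (simp add: cube_def)
    then show ?thesis using s(1) by simp
  qed
qed

text \<open>Counts sets outside a ball before a compression by those outside afterwards; exceptional
  sets that enter the ball are left out of \<open>Y\<close> and counted separately.\<close>

lemma card_push_diff:
  assumes A: "A \<subseteq> cube n" and UV: "up_pair n U V" and Y: "Y \<subseteq> A"
    and B: "\<And>x. x \<in> Y \<Longrightarrow> push U V A x \<notin> B"
  shows "card Y \<le> card (compr U V A - B)"
proof (rule card_inj_on_le)
  have d: "U \<inter> V = {}" "U \<subseteq> {1..n}" using UV by (auto simp: up_pair_def)
  note bij = push_bij[OF d(1), of A]
  show "inj_on (push U V A) Y" using bij Y inj_on_subset by (auto simp: bij_betw_def)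
  show "push U V A ` Y \<subseteq> compr U V A - B" using bij Y B by (auto simp: bij_betw_def)
  show "finite (compr U V A - B)" using finite_in[OF compr_cube[OF d A]] by simp
qed

text \<open>Only these sets can enter the ball \<open>H\<close> when they are moved by the compression.\<close>

lemma card_critical_le:
  assumes UV: "up_pair n U V" "V \<noteq> {}"
  shows "2 * card {x \<in> cube n. card x = k - 1 \<and> V \<subseteq> x \<and> U \<inter> x = {}} \<le> M"
proof -
  let ?Z = "{x \<in> cube n. card x = k - 1 \<and> V \<subseteq> x \<and> U \<inter> x = {}}"
  have sub: "U \<subseteq> {1..n}" "V \<subseteq> {1..n}" "U \<inter> V = {}" "card U = Suc (card V)"
    using UV(1) by (auto simp: up_pair_def)
  have fin: "finite U" "finite V" using sub finite_subset by blast+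
  define a where "a = card V"
  have a: "0 < a" using UV(2) fin by (simp add: a_def card_gt_0_iff)
  have cUV: "card (U \<union> V) = 2 * a + 1" using card_Un_disjoint[OF fin sub(3)] sub(4) by (simp add: a_def)
  have "U \<union> V \<subseteq> {1..n}" using sub by blast
  then have le: "2 * a + 1 \<le> n" using cUV card_mono[of "{1..n}" "U \<union> V"] by simp
  have cR: "card ({1..n} - (U \<union> V)) = n - 1 - 2 * a"
    using cUV fin \<open>U \<union> V \<subseteq> {1..n}\<close> by (simp add: card_Diff_subset)
  show ?thesis
  proof (cases "a \<le> k - 1")
    case True
    \<comment> \<open>Removing the prescribed \<open>V\<close> leaves a free choice of
      \<open>k - 1 - a\<close> points among the \<open>n - 1 - 2 * a\<close> coordinates outside
      \<open>U \<union> V\<close>.\<close>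
    have "card ?Z \<le> card {y. y \<subseteq> {1..n} - (U \<union> V) \<and> card y = k - 1 - a}"
    proof (rule card_inj_on_le)
      show "inj_on (\<lambda>x. x - V) ?Z" by (rule inj_onI) blast
      show "(\<lambda>x. x - V) ` ?Z \<subseteq> {y. y \<subseteq> {1..n} - (U \<union> V) \<and> card y = k - 1 - a}"
      proof
        fix y assume "y \<in> (\<lambda>x. x - V) ` ?Z"
        then obtain x where x: "x \<in> cube n" "card x = k - 1" "V \<subseteq> x" "U \<inter> x = {}" "y = x - V" by blast
        then have "card y = k - 1 - a" using fin by (simp add: card_Diff_subset a_def)
        moreover have "y \<subseteq> {1..n} - (U \<union> V)" using x unfolding cube_def by blast
        ultimately show "y \<in> {y. y \<subseteq> {1..n} - (U \<union> V) \<and> card y = k - 1 - a}" by simp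
      qed
      show "finite {y. y \<subseteq> {1..n} - (U \<union> V) \<and> card y = k - 1 - a}" by simp
    qed
    also have "\<dots> = (n - 1 - 2 * a) choose (k - 1 - a)" unfolding cR[symmetric] by (rule n_subsets) simp
    finally have "card ?Z \<le> (n - 1 - 2 * a) choose (k - 1 - a)" .
    moreover have "2 * a \<le> n - 1" using le by linarith
    ultimately show ?thesis
      using twice_binomial_le[OF a _ True, of "n - 1"] unfolding M_def by linarith
  next
    case False
    have "a \<le> card x" if "x \<in> cube n" "V \<subseteq> x" for x
      using card_mono[OF finite_in_cube[OF that(1)] that(2)] by (simp add: a_def)
    then have "?Z = {}" using False by fastforce
    then show ?thesis by (simp only: card.empty)
  qed
qed

text \<open>Compress, apply induction, then undo the step: only critical sets can have entered
  \<open>H\<close>, and there are at most \<open>M / 2\<close> of them.\<close>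

lemma tight_upset:
  assumes "tight A" "upset n A"
  shows "real (card (A - H)) \<le> \<tau>"
  using assms
proof (induction "\<Sum>x\<in>A. n - card x" arbitrary: A rule: less_induct)
  case less
  have A: "A \<subseteq> cube n" "card A = m" using less.prems(1) by (auto simp: tight_def)
  show ?case
  proof (cases "\<forall>U V. up_pair n U V \<longrightarrow> compr_stable U V A")
    case True
    \<comment> \<open>A fully stable family with a member smaller than \<open>k\<close> contains all
      of \<open>H\<close>, hence equals \<open>H\<close> by size.\<close>
    have "A \<subseteq> H"
    proof (rule ccontr)
      assume "\<not> A \<subseteq> H"
      then obtain x where x: "x \<in> A" "x \<notin> H" by blast
      then have "card x < k" using A(1) by (auto simp: H_def)
      then have "H \<subseteq> A"
        using all_up_stable[OF _ A(1) x(1)] True by (auto simp: H_def)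
      then have "H = A" using card_subset_eq[OF finite_in[OF A(1)]] A(2) by (simp add: m_def)
      then show False using x by blast
    qed
    then have "A - H = {}" by blast
    then have "card (A - H) = 0" by (simp only: card.empty)
    then show ?thesis using tau(1) by (simp only: of_nat_0)
  next
    case False
    then obtain U V where UV: "up_pair n U V" "\<not> compr_stable U V A"
      and st: "\<And>u v. u \<in> U \<Longrightarrow> v \<in> V \<Longrightarrow> compr_stable (U - {u}) (V - {v}) A"
      using minimal_unstable_up_pair by metis
    have V0: "V \<noteq> {}"
    proof
      assume "V = {}"
      then obtain i where "U = {i}" "i \<in> {1..n}"
        using UV(1) by (auto simp: up_pair_def card_1_singleton_iff)
      then show False using UV(2) \<open>V = {}\<close> less.prems(2) unfolding upset_iff_stable by blast
    qed
    have IH: "real (card (compr U V A - H)) \<le> \<tau>"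
      by (rule less.hyps[OF deficit_compr_less[OF A(1) UV]])
        (rule tight_compr[OF less.prems(1) UV(1) st] upset_compr_up_pair[OF UV(1) V0 A(1) less.prems(2) st]; assumption)+
    let ?Z = "{x \<in> cube n. card x = k - 1 \<and> V \<subseteq> x \<and> U \<inter> x = {}}"
    \<comment> \<open>A compression raises a size by exactly one, so a set outside \<open>H\<close>
      can enter only from size \<open>k - 1\<close>.\<close>
    have "card (A - H - ?Z) \<le> card (compr U V A - H)"
    proof (rule card_push_diff[OF A(1) UV(1)])
      fix x assume x: "x \<in> A - H - ?Z"
      then have xc: "x \<in> cube n" "card x < k" using A(1) by (auto simp: H_def)
      show "push U V A x \<notin> H"
      proof (cases "V \<subseteq> x \<and> U \<inter> x = {} \<and> swap U V x \<notin> A")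
        case True
        then have "card x \<noteq> k - 1" using x xc by blast
        moreover have "card (swap U V x) = Suc (card x)"
          using card_swap_up_pair(1)[OF UV(1) _ _ xc(1)] True by blast
        ultimately have "card (swap U V x) < k" using xc(2) by simp
        then show ?thesis using True by (simp add: push_def H_def)
      next
        case False
        then have "push U V A x = x" by (simp only: push_def if_False)
        then show ?thesis using x by simp
      qed
    qed blast
    moreover have "card (A - H) \<le> card (A - H - ?Z) + card ?Z"
    proof -
      have "card (A - H) \<le> card ((A - H - ?Z) \<union> ?Z)"
        using finite_in[OF A(1)] by (intro card_mono) (auto simp: finite_cube)
      then show ?thesis using card_Un_le[of "A - H - ?Z" ?Z] by linarith
    qed
    moreover have "2 * card ?Z \<le> M" by (rule card_critical_le[OF UV(1) V0])
    ultimately have "2 * real (card (A - H)) \<le> 2 * \<tau> + real M" using IH by linarith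
    then have "real (card (A - ball {1..n})) < real M - \<tau>" using tau(2) unfolding ball_full by linarith
    then show ?thesis using tight_gap[OF less.prems(1), of "{1..n}"] unfolding ball_full by (simp add: cube_def)
  qed
qed

text \<open>If \<open>i\<close> were missing from \<open>C\<close>, the ball would favour the lower
  end of \<open>M\<close> edges in direction \<open>i\<close>, whereas \<open>A\<close> never
  contains a lower end alone. The resulting \<open>M\<close> disagreements exceed
  \<open>2 * \<tau>\<close>.\<close>

lemma uncompress_center:
  assumes A: "A \<subseteq> cube n" "card A = m" and i: "i \<in> {1..n}" and C: "C \<in> cube n"
    and st: "compr_stable {i} {} A" and small: "real (card (A - ball C)) \<le> \<tau>"
  shows "i \<in> C"
proof (rule ccontr)
  assume iC: "i \<notin> C"
  \<comment> \<open>Selects the end of the edge where \<open>A\<close> and the ball disagree: the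
    upper end if it lies in \<open>A\<close>, otherwise the lower end, which stability then excludes
    from \<open>A\<close>.\<close>
  let ?g = "\<lambda>x. if insert i x \<in> A then insert i x else x"
  have "card (sphere i C) \<le> card ((A - ball C) \<union> (ball C - A))"
  proof (rule card_inj_on_le)
    show "inj_on ?g (sphere i C)"
    proof (rule inj_onI)
      fix x y assume xy: "x \<in> sphere i C" "y \<in> sphere i C" "?g x = ?g y"
      have g: "?g z - {i} = z" if "z \<in> sphere i C" for z using that by (simp add: sphere_def)
      show "x = y" by (rule box_equals[OF _ g[OF xy(1)] g[OF xy(2)]]) (simp only: xy(3))
    qed
    show "?g ` sphere i C \<subseteq> (A - ball C) \<union> (ball C - A)"
    proof
      fix y assume "y \<in> ?g ` sphere i C"
      then obtain x where x: "x \<in> sphere i C" "y = ?g x" by blast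
      then have xi: "x \<in> cube n" "i \<notin> x" "card (sym_diff x (C - {i})) = n - k"
        by (auto simp: sphere_def)
      have "x \<in> ball C" "insert i x \<notin> ball C"
        using mem_ball_section[OF C xi(1,2) i] xi(3) iC by simp_all
      moreover have "insert i x \<in> A" if "x \<in> A"
        using compr_stableD[OF st that] xi(2) by simp
      ultimately show "y \<in> (A - ball C) \<union> (ball C - A)" using x(2) by auto
    qed
    show "finite ((A - ball C) \<union> (ball C - A))"
      using finite_in[OF A(1)] finite_in[OF ball_cube] by simp
  qed
  also have "\<dots> \<le> card (A - ball C) + card (ball C - A)" by (rule card_Un_le)
  finally have "M \<le> 2 * card (A - ball C)"
    using card_sphere[OF C i] card_ball_diff[OF C A] by simp
  then have "real M \<le> 2 * real (card (A - ball C))" by linarith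
  then show False using small tau by linarith
qed

lemma uncompress:
  assumes A: "tight A" and i: "i \<in> {1..n}" and C: "C \<in> cube n"
    and small: "real (card (compr {i} {} A - ball C)) \<le> \<tau>"
  shows "\<exists>C\<in>cube n. real (card (A - ball C)) \<le> \<tau>"
proof -
  let ?A = "compr {i} {} A" and ?C = "C - {i}"
  have UV: "up_pair n {i} {}" using i by (simp add: up_pair_def)
  have Ac: "A \<subseteq> cube n" "card A = m" using A by (auto simp: tight_def)
  have finA: "finite A" using finite_in[OF Ac(1)] .
  have A': "?A \<subseteq> cube n" "card ?A = m"
    using compr_cube[of "{i}" "{}" n A] card_compr[of "{i}" "{}" A] i Ac by auto
  have iC: "i \<in> C" by (rule uncompress_center[OF A' i C compr_stable_compr_up small])
  have C': "?C \<in> cube n" "i \<notin> ?C" "?C - {i} = ?C" using C by (auto simp: cube_def)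
  have push: "push {i} {} A x = (if i \<notin> x \<and> insert i x \<notin> A then insert i x else x)" for x
    by (simp add: push_def swap_def)
  \<comment> \<open>The members that enter \<open>ball C\<close> when compressed; their number is
    the \<open>s\<close> of the dichotomy between the two centres.\<close>
  define X where "X = {x \<in> A. i \<notin> x \<and> x \<notin> ball C \<and> insert i x \<in> ball C \<and> insert i x \<notin> A}"
  have X: "X \<subseteq> sphere i C"
  proof
    fix x assume "x \<in> X"
    then have x: "x \<in> cube n" "i \<notin> x" "x \<notin> ball C" "insert i x \<in> ball C"
      using Ac(1) by (auto simp: X_def)
    then have "card (sym_diff x (C - {i})) = n - k"
      using mem_ball_section[OF C x(1,2) i] iC by simp
    then show "x \<in> sphere i C" using x by (simp add: sphere_def)
  qed
  have finS: "finite (sphere i C)" by (simp add: sphere_def finite_cube)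
  have sM: "card X \<le> M" using card_mono[OF finS X] card_sphere[OF C i] by simp
  have 1: "card (A - ball C) \<le> card (?A - ball C) + card X"
  proof -
    have "card (A - ball C - X) \<le> card (?A - ball C)"
    proof (rule card_push_diff[OF Ac(1) UV])
      fix x assume "x \<in> A - ball C - X"
      then show "push {i} {} A x \<notin> ball C" unfolding push by (auto simp: X_def)
    qed blast
    moreover have "card (A - ball C) \<le> card ((A - ball C - X) \<union> X)"
      using finA by (intro card_mono) (auto simp: X_def)
    ultimately show ?thesis using card_Un_le[of "A - ball C - X" X] by linarith
  qed
  \<comment> \<open>For the flipped centre, sets outside both balls stay outside
    \<open>ball C\<close> when pushed, while those only in \<open>ball C\<close> are upper ends of
    separated edges not represented in \<open>X\<close>.\<close>
  have 2: "card (A - ball ?C) \<le> card (?A - ball C) + (M - card X)"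
  proof -
    define Y1 where "Y1 = {x \<in> A. x \<in> ball C \<and> x \<notin> ball ?C}"
    define Y2 where "Y2 = {x \<in> A. x \<notin> ball C \<and> x \<notin> ball ?C}"
    have "card Y2 \<le> card (?A - ball C)"
    proof (rule card_push_diff[OF Ac(1) UV])
      fix x assume "x \<in> Y2"
      then have x: "x \<in> cube n" "x \<notin> ball C" "x \<notin> ball ?C" using Ac(1) by (auto simp: Y2_def)
      have "insert i x \<notin> ball C" if "i \<notin> x"
        using mem_ball_section[OF C x(1) that i] mem_ball_section[OF C'(1) x(1) that i] x(3) iC C'(2,3)
        by simp
      then show "push {i} {} A x \<notin> ball C" unfolding push using x(2) by simp
    qed (simp add: Y2_def)
    moreover have "card Y1 \<le> card (sphere i C - X)"
    proof (rule card_inj_on_le)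
      have Y1: "i \<in> x \<and> x - {i} \<in> sphere i C - X" if "x \<in> Y1" for x
      proof -
        have x: "x \<in> A" "x \<in> cube n" "x \<in> ball C" "x \<notin> ball ?C" using that Ac(1) by (auto simp: Y1_def)
        have ix: "i \<in> x"
        proof (rule ccontr)
          assume "i \<notin> x"
          then show False
            using mem_ball_section(1)[OF C x(2) _ i] mem_ball_section(1)[OF C'(1) x(2) _ i] x(3,4) iC C'(2,3)
            by simp
        qed
        have y: "x - {i} \<in> cube n" "i \<notin> x - {i}" "insert i (x - {i}) = x"
          using x(2) ix by (auto simp: cube_def)
        have "card (sym_diff (x - {i}) (C - {i})) = n - k"
          using mem_ball_section(2)[OF C y(1,2) i] mem_ball_section(2)[OF C'(1) y(1,2) i] x(3,4) iC C'(2,3)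
          unfolding y(3) by simp
        then have "x - {i} \<in> sphere i C" using y by (simp add: sphere_def)
        moreover have "x - {i} \<notin> X" using x(1) y(3) by (simp add: X_def)
        ultimately show ?thesis using ix by blast
      qed
      show "inj_on (\<lambda>x. x - {i}) Y1" by (rule inj_onI) (metis Y1 insert_Diff)
      show "(\<lambda>x. x - {i}) ` Y1 \<subseteq> sphere i C - X" using Y1 by blast
    qed (use finS in simp)
    moreover have "card (sphere i C - X) = M - card X"
      using card_Diff_subset[OF finite_subset[OF X finS] X] card_sphere[OF C i] by simp
    moreover have "A - ball ?C = Y1 \<union> Y2" by (auto simp: Y1_def Y2_def)
    ultimately show ?thesis using card_Un_le[of Y1 Y2] by simp
  qed
  show ?thesis
  proof (cases "2 * card X \<le> M")
    case True
    then have "real (card (A - ball C)) < real M - \<tau>" using 1 small tau by linarith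
    then show ?thesis using tight_gap[OF A C] C by blast
  next
    case False
    then have "real (card (A - ball ?C)) < real M - \<tau>" using 2 small tau by linarith
    then show ?thesis using tight_gap[OF A C'(1)] C'(1) by blast
  qed
qed

theorem tight_near_ball:
  assumes "tight A"
  shows "\<exists>C\<in>cube n. real (card (A - ball C)) \<le> \<tau>"
  using assms
proof (induction "\<Sum>x\<in>A. n - card x" arbitrary: A rule: less_induct)
  case less
  have A: "A \<subseteq> cube n" using less.prems by (auto simp: tight_def)
  show ?case
  proof (cases "upset n A")
    case True
    then show ?thesis using tight_upset[OF less.prems] ball_full by (intro bexI[of _ "{1..n}"]) (auto simp: cube_def)
  next
    case False
    then obtain i where i: "i \<in> {1..n}" "\<not> compr_stable {i} {} A" unfolding upset_iff_stable by blast
    have UV: "up_pair n {i} {}" using i by (simp add: up_pair_def)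
    \<comment> \<open>With \<open>V\<close> empty the stability hypotheses of
      \<open>tight_compr\<close> are vacuous.\<close>
    have "tight (compr {i} {} A)" using tight_compr[OF less.prems UV] by blast
    then obtain C where "C \<in> cube n" "real (card (compr {i} {} A - ball C)) \<le> \<tau>"
      using less.hyps[OF deficit_compr_less[OF A UV i(2)]] by blast
    then show ?thesis using uncompress[OF less.prems i(1)] by blast
  qed
qed

end

section \<open>Choice of constants and conclusion\<close>

theorem theorem1p1:
  fixes n k m :: nat and \<delta> c :: real and \<A> :: "nat set set"
  assumes "1 \<le> n" and "1 \<le> k" and "k \<le> n"
    and "0 < \<delta>" and "\<delta> < 1"
    and "c = \<delta> / 10 ^ 3"
    and "\<A> \<subseteq> cube n"
    and "m = (\<Sum>i=k..n. n choose i)"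
    and "card \<A> = m"
    and "real (card (vertex_boundary n \<A>)) \<le> (1 + c / real n) * real (n choose (k - 1))"
  shows "\<exists>\<H>. hamming_ball n \<H> \<and>
    real (card (sym_diff \<A> \<H>)) \<le> \<delta> * real ((n - 1) choose (k - 1)) \<and>
    (\<forall>D. card (sym_diff \<A> \<H>) = 2 * D \<longrightarrow>
       card (vertex_boundary n \<A>) \<ge>
       card (vertex_boundary n
         (initial_segment n (m - D) \<union> (initial_segment n (m + D) - initial_segment n m))))"
proof -
  define M where "M = (n - 1) choose (k - 1)"
  have M0: "0 < real M" using assms by (simp add: M_def)
  \<comment> \<open>Chosen so that \<open>c * M = \<tau> / 2\<close>, the slack allowed in
    \<open>tight\<close>; \<open>\<delta> < 1\<close> makes \<open>4 * \<tau>\<close> smaller than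
    \<open>M\<close>.\<close>
  define \<tau> where "\<tau> = \<delta> * real M / 500"
  have tau: "0 \<le> \<tau>" "4 * \<tau> < real M" using M0 assms(4,5) by (simp_all add: \<tau>_def)
  interpret L: layers n k using assms(2,3) by unfold_locales
  have LM: "L.M = M" by (simp add: L.M_def M_def)
  have Lm: "L.m = m" by (simp add: L.m_def L.H_def card_top_layers assms(8))
  interpret S: stability n k \<tau> using tau by unfold_locales (simp_all add: LM)
  have abs: "(real n - real k + 1) * real (n choose (k - 1)) = real n * real M"
  proof -
    have "(n - (k - 1)) * (n choose (k - 1)) = n * M" unfolding M_def by (rule binomial_absorb_comp)
    then have "real (n - (k - 1)) * real (n choose (k - 1)) = real n * real M"
      by (metis of_nat_mult)
    moreover have "real (n - (k - 1)) = real n - real k + 1" using assms(2,3) by (simp add: of_nat_diff)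
    ultimately show ?thesis by (simp only:)
  qed
  have "(real n - real k + 1) * real (card (vertex_boundary n \<A>))
      \<le> (real n - real k + 1) * ((1 + c / real n) * real (n choose (k - 1)))"
    using assms(3,10) by (intro mult_left_mono) auto
  also have "\<dots> = (1 + c / real n) * (real n * real M)" unfolding abs[symmetric] by (simp only: mult_ac)
  also have "\<dots> = real n * real M + \<tau> / 2"
    using assms(1,6) by (simp add: \<tau>_def field_simps)
  finally have "S.tight \<A>"
    using card_nbr[OF assms(7)] assms(7,9) by (simp add: S.tight_def Lm LM)
  then obtain C where C: "C \<in> cube n" "real (card (\<A> - L.ball C)) \<le> \<tau>"
    using S.tight_near_ball by blast
  \<comment> \<open>Equal sizes make both one-sided differences equal, so the \<open>D\<close> of
    the statement is the number of members outside the ball.\<close>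
  have "card (sym_diff \<A> (L.ball C)) = card (\<A> - L.ball C) + card (L.ball C - \<A>)"
    using L.finite_in[OF assms(7)] L.finite_in[OF L.ball_cube] by (intro card_Un_disjoint) auto
  then have sd: "card (sym_diff \<A> (L.ball C)) = 2 * card (\<A> - L.ball C)"
    using L.card_ball_diff[OF C(1) assms(7)] assms(9) by (simp add: Lm)
  show ?thesis
  proof (intro exI conjI allI impI)
    show "hamming_ball n (L.ball C)" using C(1) unfolding hamming_ball_def by blast
    have "2 * \<tau> \<le> \<delta> * real M" using M0 assms(4) by (simp add: \<tau>_def)
    then show "real (card (sym_diff \<A> (L.ball C))) \<le> \<delta> * real ((n - 1) choose (k - 1))"
      using C(2) unfolding sd M_def by simp
    fix D assume "card (sym_diff \<A> (L.ball C)) = 2 * D"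
    then have D: "card (\<A> - L.ball C) = D" using sd by simp
    moreover have "D < M" using C(2) D tau by linarith
    ultimately show "card (vertex_boundary n
         (initial_segment n (m - D) \<union> (initial_segment n (m + D) - initial_segment n m)))
       \<le> card (vertex_boundary n \<A>)"
      using L.boundary_extremal_le_ball[OF assms(7) _ C(1)] assms(9) by (simp add: Lm LM)
  qed
qed

end
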